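(* Let $\mathcal{B}_1,\mathcal{B}_2\in\mathcal{L}^q$ and $\Phi_1,\Phi_2\in\mathbb{R}_s^{q\times q}[\zeta,\eta]$. Assume that, for $i=1,2$, there is a storage function $Q_{\Psi_i}$ for $(\mathcal{B}_i,Q_{\Phi_i})$, with $\Psi_i\in\mathbb{R}_s^{q\times q}[\zeta,\eta]$, such that $Q_{\Psi_i}\stackrel{\mathcal{B}_i}{\geq}0$. Define $\mathcal{B}:=\mathcal{B}_1\cap\mathcal{B}_2$ and assume that there exist scalars $\alpha_1>0$ and $\alpha_2\ge 0$ such that $$\alpha_1Q_{\Phi_1}+\alpha_2Q_{\Phi_2}\stackrel{\mathcal{B}}{\leq}0.$$ Then: (i) $\mathcal{B}$ is stable if $Q_{\Psi_1}\stackrel{\mathcal{B}_1}{>}0$; (ii) $\mathcal{B}$ is asymptotically stable if $Q_{\Psi_1}$ satisfies the dissipation inequality strictly, that is, $\frac{d}{dt}Q_{\Psi_1}\stackrel{\mathcal{B}_1}{<}Q_{\Phi_1}$.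
   Context: Behaviors. $\mathcal{L}^q$ is the set of all $\mathcal{B}\subseteq\mathcal{C}^\infty(\mathbb{R},\mathbb{R}^q)$ of the form $\mathcal{B}=\{w\in\mathcal{C}^\infty(\mathbb{R},\mathbb{R}^q)\mid R(\frac{d}{dt})w=0\}$ for some real polynomial matrix $R\in\mathbb{R}^{p\times q}[\xi]$ (some $p$). Quadratic differential forms (QDFs). $\mathbb{R}_s^{q\times q}[\zeta,\eta]$ is the set of symmetric two-variable real polynomial matrices $\Phi(\zeta,\eta)=\sum_{k,l=0}^N\Phi_{kl}\zeta^k\eta^l$ with $\Phi_{kl}\in\mathbb{R}^{q\times q}$ and $\Phi_{kl}=\Phi_{lk}^\top$ for all $k,l$. Such $\Phi$ induces the QDF $Q_\Phi:\mathcal{C}^\infty(\mathbb{R},\mathbb{R}^q)\to\mathcal{C}^\infty(\mathbb{R},\mathbb{R})$, $(Q_\Phi(w))(t)=\sum_{k,l=0}^N\left(\frac{d^kw}{dt^k}(t)\right)^\top\Phi_{kl}\left(\frac{d^lw}{dt^l}(t)\right)$. The derivative $\frac{d}{dt}Q_\Phi$ is the map $w\mapsto\frac{d}{dt}(Q_\Phi(w))$, which is again a QDF, induced by $(\zeta+\eta)\Phi(\zeta,\eta)$. Sign conditions on a behavior. For $\mathcal{B}\in\mathcal{L}^q$: $Q_\Phi\stackrel{\mathcal{B}}{\geq}0$ means $(Q_\Phi(w))(t)\ge 0$ for all $w\in\mathcal{B}$ and all $t\in\mathbb{R}$. $Q_\Phi\stackrel{\mathcal{B}}{>}0$ means $Q_\Phi\stackrel{\mathcal{B}}{\geq}0$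 and the only $w\in\mathcal{B}$ for which $Q_\Phi(w)$ is identically zero (for all $t\in\mathbb{R}$) is $w=0$. For two QDFs, $Q\stackrel{\mathcal{B}}{\leq}Q'$ means $Q'-Q\stackrel{\mathcal{B}}{\geq}0$ and $Q\stackrel{\mathcal{B}}{<}Q'$ means $Q'-Q\stackrel{\mathcal{B}}{>}0$. Storage functions. $Q_\Psi$ is a storage function for $(\mathcal{B},Q_\Phi)$ if the dissipation inequality $\frac{d}{dt}Q_\Psi\stackrel{\mathcal{B}}{\leq}Q_\Phi$ holds; it satisfies the dissipation inequality strictly if $\frac{d}{dt}Q_\Psi\stackrel{\mathcal{B}}{<}Q_\Phi$. Stability. $\mathcal{B}\in\mathcal{L}^q$ is autonomous if whenever $w_1,w_2\in\mathcal{B}$ satisfy $w_1(t)=w_2(t)$ for all $t<0$, then $w_1=w_2$. An autonomous $\mathcal{B}$ is stable if every $w\in\mathcal{B}$ is bounded on $[0,\infty)$, and asymptotically stable if $\lim_{t\to\infty}w(t)=0$ for all $w\in\mathcal{B}$. The assertion that $\mathcal{B}$ is stable (asymptotically stable) is understood to include that $\mathcal{B}$ is autonomous. *)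

theory Defs
  imports "HOL-Analysis.Analysis" "HOL-Computational_Algebra.Polynomial"
begin

type_synonym 'q signal = "real \<Rightarrow> real ^ 'q"

definition ddt :: "(real \<Rightarrow> 'a::real_normed_vector) \<Rightarrow> real \<Rightarrow> 'a" where
  "ddt f = (\<lambda>t. vector_derivative f (at t))"

text \<open>\<^const>\<open>vector_derivative\<close> is total, so smoothness has to require that every iterate
  is actually differentiable.\<close>

definition smooth :: "(real \<Rightarrow> 'a::real_normed_vector) \<Rightarrow> bool" where
  "smooth f \<longleftrightarrow> (\<forall>k t. (ddt ^^ k) f differentiable (at t))"

text \<open>A polynomial matrix with \<open>q\<close> columns is given by the list of its rows, each a polynomial
  with coefficients in \<open>\<real>\<^sup>q\<close>. A list is used because the number of rows is existentially
  quantified in the definition of a behavior, so it cannot be a type. The empty list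
  has the same kernel as a single zero row, namely all smooth signals.\<close>

definition row_op :: "(real ^ 'q) poly \<Rightarrow> 'q::finite signal \<Rightarrow> real \<Rightarrow> real" where
  "row_op r w t = (\<Sum>k\<le>degree r. coeff r k \<bullet> (ddt ^^ k) w t)"

definition kernel_behavior :: "(real ^ 'q) poly list \<Rightarrow> 'q::finite signal set" where
  "kernel_behavior R = {w. smooth w \<and> (\<forall>r\<in>set R. \<forall>t. row_op r w t = 0)}"

definition behaviors :: "'q::finite signal set set" where
  "behaviors = range kernel_behavior"

text \<open>A two-variable polynomial matrix \<open>\<Phi>(\<zeta>,\<eta>) = \<Sum>\<^sub>k\<^sub>,\<^sub>l \<Phi>\<^sub>k\<^sub>l \<zeta>\<^sup>k \<eta>\<^sup>l\<close> is a polynomial in \<open>\<zeta>\<close> whose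
  coefficients are polynomials in \<open>\<eta>\<close> with matrix coefficients.\<close>

type_synonym 'q poly2_matrix = "(real ^ 'q ^ 'q) poly poly"

definition coeff2 :: "'q::finite poly2_matrix \<Rightarrow> nat \<Rightarrow> nat \<Rightarrow> real ^ 'q ^ 'q" where
  "coeff2 \<Phi> k l = coeff (coeff \<Phi> k) l"

definition sym_poly2 :: "'q::finite poly2_matrix set" where
  "sym_poly2 = {\<Phi>. \<forall>k l. coeff2 \<Phi> k l = transpose (coeff2 \<Phi> l k)}"

definition qdf :: "'q::finite poly2_matrix \<Rightarrow> 'q signal \<Rightarrow> real \<Rightarrow> real" where
  "qdf \<Phi> w t = (\<Sum>k\<le>degree \<Phi>. \<Sum>l\<le>degree (coeff \<Phi> k).
     (ddt ^^ k) w t \<bullet> (coeff2 \<Phi> k l *v (ddt ^^ l) w t))"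

text \<open>The sign conditions are stated for arbitrary maps from signals to real functions, so that
  they apply to derivatives and linear combinations of quadratic differential forms.\<close>

definition nonneg_on :: "'q::finite signal set \<Rightarrow> ('q signal \<Rightarrow> real \<Rightarrow> real) \<Rightarrow> bool" where
  "nonneg_on B Q \<longleftrightarrow> (\<forall>w\<in>B. \<forall>t. Q w t \<ge> 0)"

definition pos_on :: "'q::finite signal set \<Rightarrow> ('q signal \<Rightarrow> real \<Rightarrow> real) \<Rightarrow> bool" where
  "pos_on B Q \<longleftrightarrow> nonneg_on B Q \<and> (\<forall>w\<in>B. (\<forall>t. Q w t = 0) \<longrightarrow> w = (\<lambda>t. 0))"

definition le_on ::
  "'q::finite signal set \<Rightarrow> ('q signal \<Rightarrow> real \<Rightarrow> real) \<Rightarrow> ('q signal \<Rightarrow> real \<Rightarrow> real) \<Rightarrow> bool" where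
  "le_on B Q Q' \<longleftrightarrow> nonneg_on B (\<lambda>w t. Q' w t - Q w t)"

definition less_on ::
  "'q::finite signal set \<Rightarrow> ('q signal \<Rightarrow> real \<Rightarrow> real) \<Rightarrow> ('q signal \<Rightarrow> real \<Rightarrow> real) \<Rightarrow> bool" where
  "less_on B Q Q' \<longleftrightarrow> pos_on B (\<lambda>w t. Q' w t - Q w t)"

definition storage_function ::
  "'q::finite signal set \<Rightarrow> 'q poly2_matrix \<Rightarrow> 'q poly2_matrix \<Rightarrow> bool" where
  "storage_function B \<Phi> \<Psi> \<longleftrightarrow> le_on B (\<lambda>w. ddt (qdf \<Psi> w)) (qdf \<Phi>)"

definition strict_dissipation ::
  "'q::finite signal set \<Rightarrow> 'q poly2_matrix \<Rightarrow> 'q poly2_matrix \<Rightarrow> bool" where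
  "strict_dissipation B \<Phi> \<Psi> \<longleftrightarrow> less_on B (\<lambda>w. ddt (qdf \<Psi> w)) (qdf \<Phi>)"

definition autonomous_behavior :: "'q::finite signal set \<Rightarrow> bool" where
  "autonomous_behavior B \<longleftrightarrow> (\<forall>w1\<in>B. \<forall>w2\<in>B. (\<forall>t<0. w1 t = w2 t) \<longrightarrow> w1 = w2)"

definition stable_behavior :: "'q::finite signal set \<Rightarrow> bool" where
  "stable_behavior B \<longleftrightarrow> autonomous_behavior B \<and> (\<forall>w\<in>B. bounded (w ` {0..}))"

definition asymptotically_stable_behavior :: "'q::finite signal set \<Rightarrow> bool" where
  "asymptotically_stable_behavior B \<longleftrightarrow> autonomous_behavior B \<and> (\<forall>w\<in>B. (w \<longlongrightarrow> 0) at_top)"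

end

theory Submission
  imports Defs
begin

text \<open>The form \<open>V = \<alpha>\<^sub>1 Q\<^sub>\<Psi>\<^sub>1 + \<alpha>\<^sub>2 Q\<^sub>\<Psi>\<^sub>2\<close> is nonnegative and nonincreasing along every \<open>w \<in> \<B>\<close>, and
  either hypothesis makes it vanish identically only for \<open>w = 0\<close>. A solution \<open>e\<^sup>t v\<close> would make it grow,
  so there is none; hence the rows of \<open>R(1)\<close> span \<open>\<real>\<^sup>q\<close>, some square submatrix of \<open>R\<close> has determinant
  \<open>p \<noteq> 0\<close>, and multiplying by its adjugate gives \<open>p(d/dt) w\<^sub>i = 0\<close>. Thus \<open>\<B>\<close> is finite-dimensional,
  with solutions determined by finitely many derivatives at \<open>0\<close>. If \<open>V\<close> vanishes at one time, it
  vanishes at all later times and, by uniqueness for linear differential equations, at all times.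
  Hence \<open>V\<close> is positive definite on \<open>\<B>\<close> at each time and, by compactness, bounds \<open>w(t)\<close>:
  this is stability. Under strict dissipation \<open>V\<close> is not constant along nonzero solutions, and
  LaSalle's invariance principle gives convergence to \<open>0\<close>.\<close>

subsection \<open>Smooth signals\<close>

lemma ddt_eqI:
  assumes "\<And>t. (f has_vector_derivative g t) (at t)"
  shows "ddt f = g"
  using assms by (auto simp: ddt_def vector_derivative_at)

text \<open>Naming all derivatives at once as a family \<open>F\<close> yields smoothness and the
  iterated derivatives together; the rules for linear maps, sums of two signals, shifts and
  exponentials each exhibit such an \<open>F\<close>.\<close>

lemma
  assumes "F 0 = f" and "\<And>k t. (F k has_vector_derivative F (Suc k) t) (at t)"
  shows funpow_ddt_eqI: "(ddt ^^ k) f = F k" and smoothI: "smooth f"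
proof -
  have *: "(ddt ^^ k) f = F k" for k
    by (induction k) (use assms in \<open>auto intro: ddt_eqI\<close>)
  then show "(ddt ^^ k) f = F k" .
  show "smooth f"
    unfolding smooth_def * using assms(2) differentiableI_vector by blast
qed

lemma smooth_has_vector_derivative:
  assumes "smooth f"
  shows "((ddt ^^ k) f has_vector_derivative (ddt ^^ Suc k) f t) (at t)"
  using assms vector_derivative_works[of "(ddt ^^ k) f" "at t"]
  by (simp add: smooth_def ddt_def)

lemma
  assumes "bounded_linear T" and f: "smooth f"
  shows funpow_ddt_linear: "(ddt ^^ k) (\<lambda>t. T (f t)) = (\<lambda>t. T ((ddt ^^ k) f t))"
    and smooth_linear: "smooth (\<lambda>t. T (f t))"
proof -
  have "((\<lambda>t. T ((ddt ^^ k) f t)) has_vector_derivative T ((ddt ^^ Suc k) f t)) (at t)" for k t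
    by (rule bounded_linear.has_vector_derivative[OF assms(1) smooth_has_vector_derivative[OF f]])
  then show "(ddt ^^ k) (\<lambda>t. T (f t)) = (\<lambda>t. T ((ddt ^^ k) f t))" "smooth (\<lambda>t. T (f t))"
    using funpow_ddt_eqI[of "\<lambda>k t. T ((ddt ^^ k) f t)"] smoothI[of "\<lambda>k t. T ((ddt ^^ k) f t)"]
    by simp_all
qed

lemma
  assumes f: "smooth f" and g: "smooth g"
  shows funpow_ddt_add: "(ddt ^^ k) (\<lambda>t. f t + g t) = (\<lambda>t. (ddt ^^ k) f t + (ddt ^^ k) g t)"
    and smooth_add: "smooth (\<lambda>t. f t + g t)"
proof -
  have "((\<lambda>t. (ddt ^^ k) f t + (ddt ^^ k) g t) has_vector_derivative
      (ddt ^^ Suc k) f t + (ddt ^^ Suc k) g t) (at t)" for k t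
    by (intro has_vector_derivative_add smooth_has_vector_derivative f g)
  then show "(ddt ^^ k) (\<lambda>t. f t + g t) = (\<lambda>t. (ddt ^^ k) f t + (ddt ^^ k) g t)"
    "smooth (\<lambda>t. f t + g t)"
    using funpow_ddt_eqI[of "\<lambda>k t. (ddt ^^ k) f t + (ddt ^^ k) g t"]
      smoothI[of "\<lambda>k t. (ddt ^^ k) f t + (ddt ^^ k) g t"] by simp_all
qed

lemma
  assumes f: "smooth f"
  shows funpow_ddt_shift: "(ddt ^^ k) (\<lambda>t. f (t + s)) = (\<lambda>t. (ddt ^^ k) f (t + s))"
    and smooth_shift: "smooth (\<lambda>t. f (t + s))"
proof -
  have "((\<lambda>t. (ddt ^^ k) f (t + s)) has_vector_derivative (ddt ^^ Suc k) f (t + s)) (at t)" for k t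
  proof -
    have "((\<lambda>t. t + s) has_vector_derivative 1) (at t)"
      by (auto intro!: derivative_eq_intros)
    from vector_diff_chain_at[OF this smooth_has_vector_derivative[OF f]] show ?thesis
      by (simp add: o_def)
  qed
  then show "(ddt ^^ k) (\<lambda>t. f (t + s)) = (\<lambda>t. (ddt ^^ k) f (t + s))" "smooth (\<lambda>t. f (t + s))"
    using funpow_ddt_eqI[of "\<lambda>k t. (ddt ^^ k) f (t + s)"]
      smoothI[of "\<lambda>k t. (ddt ^^ k) f (t + s)"] by simp_all
qed

lemma
  fixes f :: "real \<Rightarrow> 'a::real_normed_vector"
  assumes "smooth f"
  shows funpow_ddt_scaleR: "(ddt ^^ k) (\<lambda>t. c *\<^sub>R f t) = (\<lambda>t. c *\<^sub>R (ddt ^^ k) f t)"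
    and smooth_scaleR: "smooth (\<lambda>t. c *\<^sub>R f t)"
  using funpow_ddt_linear[OF bounded_linear_scaleR_right assms]
    smooth_linear[OF bounded_linear_scaleR_right assms] by auto

lemma
  fixes w :: "'q::finite signal"
  assumes "smooth w"
  shows funpow_ddt_component: "(ddt ^^ k) (\<lambda>t. w t $ i) = (\<lambda>t. (ddt ^^ k) w t $ i)"
    and smooth_component: "smooth (\<lambda>t. w t $ i)"
  using funpow_ddt_linear[OF bounded_linear_vec_nth assms]
    smooth_linear[OF bounded_linear_vec_nth assms] by auto

lemma
  shows funpow_ddt_zero: "(ddt ^^ k) (\<lambda>t. 0) = (\<lambda>t. 0)"
    and smooth_zero: "smooth (\<lambda>t. 0)"
  using funpow_ddt_eqI[of "\<lambda>k t. 0"] smoothI[of "\<lambda>k t. 0"] by auto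

lemma
  assumes "finite I" and "\<And>i. i \<in> I \<Longrightarrow> smooth (f i)"
  shows funpow_ddt_sum: "(ddt ^^ k) (\<lambda>t. \<Sum>i\<in>I. f i t) = (\<lambda>t. \<Sum>i\<in>I. (ddt ^^ k) (f i) t)"
    and smooth_sum: "smooth (\<lambda>t. \<Sum>i\<in>I. f i t)"
proof -
  have "smooth (\<lambda>t. \<Sum>i\<in>I. f i t) \<and>
      (ddt ^^ k) (\<lambda>t. \<Sum>i\<in>I. f i t) = (\<lambda>t. \<Sum>i\<in>I. (ddt ^^ k) (f i) t)"
    using assms
    by (induction I rule: finite_induct)
      (auto simp: funpow_ddt_zero smooth_zero smooth_add funpow_ddt_add)
  then show "(ddt ^^ k) (\<lambda>t. \<Sum>i\<in>I. f i t) = (\<lambda>t. \<Sum>i\<in>I. (ddt ^^ k) (f i) t)"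
    "smooth (\<lambda>t. \<Sum>i\<in>I. f i t)" by auto
qed

lemma
  shows funpow_ddt_exp: "(ddt ^^ k) (\<lambda>t. exp t *\<^sub>R v) = (\<lambda>t. exp t *\<^sub>R v)"
    and smooth_exp: "smooth (\<lambda>t. exp t *\<^sub>R v)"
proof -
  have "((\<lambda>t. exp t *\<^sub>R v) has_vector_derivative exp t *\<^sub>R v) (at t)" for t
    by (auto intro!: derivative_eq_intros simp: has_real_derivative_iff_has_vector_derivative[symmetric])
  then show "(ddt ^^ k) (\<lambda>t. exp t *\<^sub>R v) = (\<lambda>t. exp t *\<^sub>R v)" "smooth (\<lambda>t. exp t *\<^sub>R v)"
    using funpow_ddt_eqI[of "\<lambda>k t. exp t *\<^sub>R v"] smoothI[of "\<lambda>k t. exp t *\<^sub>R v"] by auto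
qed

lemma smooth_ddt: "smooth f \<Longrightarrow> smooth (ddt f)"
  unfolding smooth_def by (metis comp_apply funpow_Suc_right)

section \<open>Closure of behaviors under linear combinations and time shifts\<close>

lemma
  shows row_op_zero: "row_op r (\<lambda>t. 0) t = 0"
    and row_op_add: "smooth v \<Longrightarrow> smooth w \<Longrightarrow>
      row_op r (\<lambda>t. v t + w t) t = row_op r v t + row_op r w t"
    and row_op_scaleR: "smooth w \<Longrightarrow> row_op r (\<lambda>t. c *\<^sub>R w t) t = c * row_op r w t"
    and row_op_shift: "smooth w \<Longrightarrow> row_op r (\<lambda>t. w (t + s)) t = row_op r w (t + s)"
  by (simp_all add: row_op_def funpow_ddt_zero funpow_ddt_add funpow_ddt_scaleR funpow_ddt_shift
      inner_add_right sum.distrib sum_distrib_left)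

lemma
  shows kernel_behavior_zero: "(\<lambda>t. 0) \<in> kernel_behavior R"
    and kernel_behavior_add: "v \<in> kernel_behavior R \<Longrightarrow> w \<in> kernel_behavior R \<Longrightarrow>
      (\<lambda>t. v t + w t) \<in> kernel_behavior R"
    and kernel_behavior_scaleR: "w \<in> kernel_behavior R \<Longrightarrow> (\<lambda>t. c *\<^sub>R w t) \<in> kernel_behavior R"
    and kernel_behavior_shift: "w \<in> kernel_behavior R \<Longrightarrow> (\<lambda>t. w (t + s)) \<in> kernel_behavior R"
    and kernel_behavior_smooth: "w \<in> kernel_behavior R \<Longrightarrow> smooth w"
  by (auto simp: kernel_behavior_def row_op_zero row_op_add row_op_scaleR row_op_shift
      smooth_zero smooth_add smooth_scaleR smooth_shift)

lemma kernel_behavior_sum: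
  assumes "finite I" and "\<And>i. i \<in> I \<Longrightarrow> g i \<in> kernel_behavior R"
  shows "(\<lambda>t. \<Sum>i\<in>I. x i *\<^sub>R g i t) \<in> kernel_behavior R"
  using assms
  by (induction I rule: finite_induct)
    (auto simp: kernel_behavior_zero intro!: kernel_behavior_add kernel_behavior_scaleR)

subsection \<open>Scalar equations satisfied by a behavior\<close>

text \<open>The scalar operator \<open>c(d/dt)\<close>. Its symbols form a commutative ring, where
  determinants and adjugates make sense, unlike the rows with vector coefficients in
  \<open>row_op\<close>.\<close>

definition poly_op :: "real poly \<Rightarrow> (real \<Rightarrow> real) \<Rightarrow> real \<Rightarrow> real" where
  "poly_op c f t = (\<Sum>k\<le>degree c. coeff c k * (ddt ^^ k) f t)"

lemma poly_op_upto:
  assumes "degree c \<le> n"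
  shows "poly_op c f t = (\<Sum>k\<le>n. coeff c k * (ddt ^^ k) f t)"
  unfolding poly_op_def using assms
  by (intro sum.mono_neutral_left) (auto simp: coeff_eq_0)

lemma poly_op_0: "poly_op 0 f t = 0"
  by (simp add: poly_op_def)

lemma poly_op_add_poly: "poly_op (c + d) f t = poly_op c f t + poly_op d f t"
proof -
  let ?n = "max (degree c) (degree d)"
  have "degree (c + d) \<le> ?n" by (rule degree_add_le_max)
  then show ?thesis
    by (simp add: poly_op_upto[of _ ?n] sum.distrib algebra_simps)
qed

lemma poly_op_smult: "poly_op (smult a c) f t = a * poly_op c f t"
  using degree_smult_le[of a c]
  by (simp add: poly_op_upto[of _ "degree c"] sum_distrib_left algebra_simps)

lemma poly_op_sum_poly: "poly_op (sum c I) f t = (\<Sum>i\<in>I. poly_op (c i) f t)"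
  by (induction I rule: infinite_finite_induct) (auto simp: poly_op_0 poly_op_add_poly)

text \<open>Multiplying the symbol by the indeterminate, which is \<open>pCons 0\<close>, amounts to
  differentiating the result.\<close>

lemma poly_op_has_vector_derivative:
  assumes "smooth f"
  shows "(poly_op c f has_vector_derivative poly_op (pCons 0 c) f t) (at t)"
proof -
  have "(poly_op c f has_vector_derivative
      (\<Sum>k\<le>degree c. coeff c k * (ddt ^^ Suc k) f t)) (at t)"
    unfolding poly_op_def
    by (intro has_vector_derivative_sum has_vector_derivative_mult_right
        smooth_has_vector_derivative assms)
  moreover have "poly_op (pCons 0 c) f t = (\<Sum>k\<le>degree c. coeff c k * (ddt ^^ Suc k) f t)"
    using degree_pCons_le[of 0 c]
    by (subst poly_op_upto[of _ "Suc (degree c)"])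
      (simp_all add: sum.atMost_Suc_shift del: sum.atMost_Suc funpow.simps)
  ultimately show ?thesis by simp
qed

text \<open>Induction on \<open>c\<close>: the constant term only rescales the equation, and a
  factor of the indeterminate differentiates a function that vanishes identically. The time
  therefore stays arbitrary in the induction.\<close>

lemma poly_op_mult_annihilates:
  fixes w :: "'q::finite signal" and r :: "'q \<Rightarrow> real poly"
  assumes w: "smooth w" and r: "\<And>t. (\<Sum>i\<in>UNIV. poly_op (r i) (\<lambda>t. w t $ i) t) = 0"
  shows "(\<Sum>i\<in>UNIV. poly_op (c * r i) (\<lambda>t. w t $ i) t) = 0"
proof (induction c arbitrary: t)
  case 0
  then show ?case by (simp add: poly_op_0)
next
  case (pCons a c)
  have "((\<lambda>t. \<Sum>i\<in>UNIV. poly_op (c * r i) (\<lambda>t. w t $ i) t) has_vector_derivative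
      (\<Sum>i\<in>UNIV. poly_op (pCons 0 (c * r i)) (\<lambda>t. w t $ i) t)) (at t)"
    by (intro has_vector_derivative_sum poly_op_has_vector_derivative smooth_component w)
  then have "(\<Sum>i\<in>UNIV. poly_op (pCons 0 (c * r i)) (\<lambda>t. w t $ i) t) = 0"
    unfolding pCons.IH using has_vector_derivative_const vector_derivative_unique_at by blast
  then show ?case
    by (simp add: poly_op_add_poly poly_op_smult sum.distrib r flip: sum_distrib_left)
qed

definition entry :: "(real ^ 'q) poly \<Rightarrow> 'q::finite \<Rightarrow> real poly" where
  "entry r i = map_poly (\<lambda>v. v $ i) r"

lemma coeff_entry: "coeff (entry r i) k = coeff r k $ i"
  by (simp add: entry_def coeff_map_poly)

lemma degree_entry_le: "degree (entry r i) \<le> degree r"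
  by (simp add: entry_def map_poly_degree_leq)

lemma row_op_eq_poly_op:
  assumes "smooth w"
  shows "row_op r w t = (\<Sum>i\<in>UNIV. poly_op (entry r i) (\<lambda>t. w t $ i) t)"
proof -
  have "poly_op (entry r i) (\<lambda>t. w t $ i) t =
      (\<Sum>k\<le>degree r. coeff r k $ i * (ddt ^^ k) w t $ i)" for i
    using assms by (simp add: poly_op_upto[OF degree_entry_le] funpow_ddt_component coeff_entry)
  then show ?thesis
    unfolding row_op_def inner_vec_def by (simp add: sum.swap[of _ UNIV])
qed

text \<open>The sum of the coefficients is the row evaluated at \<open>1\<close>, which is what acts
  on \<open>v\<close> when the row operator meets \<open>exp t *\<^sub>R v\<close>.\<close>

lemma poly_entry_1: "poly (entry r i) 1 = (\<Sum>k\<le>degree r. coeff r k) $ i"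
proof -
  have "poly (entry r i) 1 = (\<Sum>k\<le>degree r. coeff (entry r i) k)"
    unfolding poly_altdef power_one mult_1_right using degree_entry_le
    by (intro sum.mono_neutral_left) (auto simp: coeff_eq_0)
  then show ?thesis by (simp add: coeff_entry)
qed

section \<open>Determinants and square submatrices\<close>

lemma det_adjugate:
  fixes A :: "'a::comm_ring_1 ^ 'n ^ 'n"
  obtains C :: "'a ^ 'n ^ 'n" where "\<And>i k. (\<Sum>j\<in>UNIV. C $ i $ j * A $ j $ k) = (if i = k then det A else 0)"
proof -
  define T where "T = transpose A"
  \<comment> \<open>The adjugate, written with \<open>T\<close> so that columns of \<open>A\<close>
    become rows. Summing over \<open>j\<close> against column \<open>k\<close> of \<open>A\<close>
    puts that column in place of row \<open>i\<close> of \<open>T\<close>; for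
    \<open>i \<noteq> k\<close> two rows then coincide.\<close>
  define C where "C = (\<chi> k j. det (\<chi> i. if i = k then axis j 1 else T $ i))"
  have "(\<Sum>j\<in>UNIV. C $ i $ j * A $ j $ k) = (if i = k then det A else 0)" for i k
  proof -
    have "C $ i $ j * A $ j $ k = det (\<chi> m. if m = i then T $ k $ j *s axis j 1 else T $ m)" for j
      by (simp add: C_def det_row_mul T_def transpose_def mult.commute)
    then have "(\<Sum>j\<in>UNIV. C $ i $ j * A $ j $ k) =
        det (\<chi> m. if m = i then (\<Sum>j\<in>UNIV. T $ k $ j *s axis j 1) else T $ m)"
      by (simp add: det_linear_row_sum)
    also have "(\<Sum>j\<in>UNIV. T $ k $ j *s axis j 1) = T $ k"
      by (simp add: vec_eq_iff axis_def if_distrib cong: if_cong)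
    also have "det (\<chi> m. if m = i then T $ k else T $ m) = (if i = k then det A else 0)"
    proof (cases "i = k")
      case True
      then have "(\<chi> m. if m = i then T $ k else T $ m) = T" by (simp add: vec_eq_iff)
      then show ?thesis using True by (simp add: T_def)
    next
      case False
      then have "row i (\<chi> m. if m = i then T $ k else T $ m) = row k (\<chi> m. if m = i then T $ k else T $ m)"
        by (simp add: row_def vec_eq_iff)
      from det_identical_rows[OF False this] show ?thesis using False by simp
    qed
    finally show ?thesis .
  qed
  then show ?thesis by (rule that)
qed

lemma poly_det:
  fixes A :: "real poly ^ 'n ^ 'n"
  shows "poly (det A) x = det (\<chi> i j. poly (A $ i $ j) x)"
  by (simp add: det_def poly_sum poly_prod)

text \<open>A basis chosen inside \<open>S\<close> has exactly \<open>CARD('n)\<close> elements, so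
  \<open>'n\<close> can index it as the rows of a square matrix. A vector in the kernel is
  orthogonal to a spanning set, hence zero.\<close>

lemma matrix_from_spanning_set:
  fixes S :: "(real ^ 'n) set"
  assumes "span S = UNIV"
  obtains f :: "'n \<Rightarrow> real ^ 'n" where "range f \<subseteq> S" and "det (\<chi> i. f i) \<noteq> 0"
proof -
  obtain b where b: "b \<subseteq> S" "independent b" "S \<subseteq> span b" "card b = dim S"
    using basis_exists by blast
  have sb: "span b = UNIV"
    using b assms by (metis span_mono span_span top.extremum_unique)
  have "card b = CARD('n)"
    using b assms by (metis dim_span dim_UNIV DIM_cart DIM_real mult.right_neutral)
  moreover have "finite b" using b(2) by (rule independent_imp_finite)
  ultimately obtain f :: "'n \<Rightarrow> real ^ 'n" where f: "bij_betw f UNIV b"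
    using finite_same_card_bij[of "UNIV :: 'n set" b] by auto
  have "x = 0" if "(\<chi> i. f i) *v x = 0" for x
  proof -
    have "y \<bullet> x = 0" if "y \<in> b" for y
    proof -
      from that f have "y \<in> range f" by (simp add: bij_betw_def)
      then obtain i where "y = f i" by blast
      then show ?thesis
        using \<open>(\<chi> i. f i) *v x = 0\<close> by (simp add: vec_eq_iff matrix_vector_mult_def inner_vec_def)
    qed
    then have "orthogonal x y" if "y \<in> span b" for y
      using that orthogonal_to_span[of y b x] by (auto simp: orthogonal_def inner_commute)
    then show ?thesis using sb by (metis UNIV_I orthogonal_self)
  qed
  then have "invertible (\<chi> i. f i)"
    using matrix_left_invertible_ker invertible_left_inverse by blast
  then show ?thesis
    using that f b(1) by (auto simp: invertible_det_nz bij_betw_def)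
qed

text \<open>Turns the absence of solutions \<open>exp t *\<^sub>R v\<close> into one scalar equation
  for every component. Testing the single exponent \<open>1\<close> suffices, since a minor of
  \<open>R\<close> that is nonzero at \<open>1\<close> is a nonzero polynomial.\<close>

lemma kernel_behavior_scalar_equation:
  fixes R :: "(real ^ 'q::finite) poly list"
  assumes "\<And>v. (\<lambda>t. exp t *\<^sub>R v) \<in> kernel_behavior R \<Longrightarrow> v = 0"
  obtains p where "p \<noteq> 0"
    and "\<And>w i t. w \<in> kernel_behavior R \<Longrightarrow> poly_op p (\<lambda>t. w t $ i) t = 0"
proof -
  let ?e = "\<lambda>r :: (real ^ 'q) poly. \<Sum>k\<le>degree r. coeff r k"
  have "span (?e ` set R) = UNIV"
  proof (rule ccontr)
    assume "span (?e ` set R) \<noteq> UNIV"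
    \<comment> \<open>The normal \<open>a\<close> of a hyperplane containing all rows of
      \<open>R(1)\<close> is annihilated by \<open>R(1)\<close>, so \<open>exp t *\<^sub>R a\<close>
      would be a nonzero solution.\<close>
    from span_not_univ_subset_hyperplane[OF this] obtain a
      where a: "a \<noteq> 0" "span (?e ` set R) \<subseteq> {x. a \<bullet> x = 0}" by blast
    have "row_op r (\<lambda>t. exp t *\<^sub>R a) t = 0" if "r \<in> set R" for r t
    proof -
      have "?e r \<in> span (?e ` set R)" using that by (intro span_base) auto
      then have "a \<bullet> ?e r = 0" using a(2) by blast
      then show ?thesis
        by (simp add: row_op_def funpow_ddt_exp inner_commute flip: sum_distrib_left inner_sum_right)
    qed
    then have "(\<lambda>t. exp t *\<^sub>R a) \<in> kernel_behavior R"
      by (simp add: kernel_behavior_def smooth_exp)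
    then show False using assms a(1) by blast
  qed
  then obtain f where f: "range f \<subseteq> ?e ` set R" "det (\<chi> i. f i) \<noteq> 0"
    using matrix_from_spanning_set by blast
  then have "\<forall>i. \<exists>r. r \<in> set R \<and> f i = ?e r" by blast
  then obtain r where r: "\<And>i. r i \<in> set R" "\<And>i. f i = ?e (r i)" by metis
  define A where "A = (\<chi> i j. entry (r i) j)"
  have "(\<chi> i j. poly (A $ i $ j) 1) = (\<chi> i. f i)"
    by (simp add: A_def poly_entry_1 r(2) vec_eq_iff)
  then have "poly (det A) 1 \<noteq> 0"
    using f(2) by (simp add: poly_det)
  then have "det A \<noteq> 0" by auto
  obtain C where C: "\<And>i k. (\<Sum>j\<in>UNIV. C $ i $ j * A $ j $ k) = (if i = k then det A else 0)"
    using det_adjugate by blast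
  have "poly_op (det A) (\<lambda>t. w t $ i) t = 0" if w: "w \<in> kernel_behavior R" for w i t
  proof -
    have sw: "smooth w" using w by (rule kernel_behavior_smooth)
    have "(\<Sum>k\<in>UNIV. poly_op (A $ j $ k) (\<lambda>t. w t $ k) t) = 0" for j t
      using w r(1) row_op_eq_poly_op[OF sw, of "r j"] by (simp add: kernel_behavior_def A_def)
    \<comment> \<open>Equation \<open>j\<close> is multiplied by \<open>C $ i $ j\<close>; summing
      over \<open>j\<close> isolates component \<open>i\<close>, as \<open>C\<close> times
      \<open>A\<close> is \<open>det A\<close> times the identity.\<close>
    then have "(\<Sum>k\<in>UNIV. poly_op (C $ i $ j * A $ j $ k) (\<lambda>t. w t $ k) t) = 0" for j
      by (rule poly_op_mult_annihilates[OF sw])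
    then have "0 = (\<Sum>j\<in>UNIV. \<Sum>k\<in>UNIV. poly_op (C $ i $ j * A $ j $ k) (\<lambda>t. w t $ k) t)"
      by simp
    also have "\<dots> = (\<Sum>k\<in>UNIV. poly_op (\<Sum>j\<in>UNIV. C $ i $ j * A $ j $ k) (\<lambda>t. w t $ k) t)"
      by (subst sum.swap) (simp add: poly_op_sum_poly)
    also have "\<dots> = (\<Sum>k\<in>UNIV. if k = i then poly_op (det A) (\<lambda>t. w t $ i) t else 0)"
      by (rule sum.cong) (auto simp: C poly_op_0)
    finally show ?thesis by simp
  qed
  then show ?thesis using that \<open>det A \<noteq> 0\<close> by blast
qed

subsection \<open>Linear differential equations\<close>

text \<open>Gronwall in both time directions: after \<open>a\<close> the product of \<open>E\<close>
  with \<open>exp (- K * t)\<close> cannot increase, before \<open>a\<close> its product with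
  \<open>exp (K * t)\<close> cannot decrease, and both are zero at \<open>a\<close>.\<close>

lemma differential_inequality_zero:
  fixes E :: "real \<Rightarrow> real"
  assumes deriv: "\<And>t. (E has_real_derivative E' t) (at t)"
    and bound: "\<And>t. \<bar>E' t\<bar> \<le> K * E t"
    and nonneg: "\<And>t. 0 \<le> E t" and "E a = 0"
  shows "E t = 0"
proof -
  have "E t \<le> 0"
  proof (cases "a \<le> t")
    case True
    have "E t * exp (- K * t) \<le> E a * exp (- K * a)"
    proof (rule DERIV_nonpos_imp_nonincreasing[OF True])
      fix x
      have "((\<lambda>s. E s * exp (- K * s)) has_real_derivative (E' x - K * E x) * exp (- K * x)) (at x)"
        by (auto intro!: derivative_eq_intros deriv simp: algebra_simps)
      moreover have "(E' x - K * E x) * exp (- K * x) \<le> 0"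
        using bound[of x] by (intro mult_nonpos_nonneg) auto
      ultimately show "\<exists>y. ((\<lambda>s. E s * exp (- K * s)) has_real_derivative y) (at x) \<and> y \<le> 0"
        by blast
    qed
    then show ?thesis using \<open>E a = 0\<close> by (simp add: mult_le_0_iff)
  next
    case False
    then have "t \<le> a" by simp
    have "E t * exp (K * t) \<le> E a * exp (K * a)"
    proof (rule DERIV_nonneg_imp_nondecreasing[OF \<open>t \<le> a\<close>])
      fix x
      have "((\<lambda>s. E s * exp (K * s)) has_real_derivative (E' x + K * E x) * exp (K * x)) (at x)"
        by (auto intro!: derivative_eq_intros deriv simp: algebra_simps)
      moreover have "0 \<le> (E' x + K * E x) * exp (K * x)"
        using bound[of x] by (intro mult_nonneg_nonneg) auto
      ultimately show "\<exists>y. ((\<lambda>s. E s * exp (K * s)) has_real_derivative y) (at x) \<and> 0 \<le> y"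
        by blast
    qed
    then show ?thesis using \<open>E a = 0\<close> by (simp add: mult_le_0_iff)
  qed
  then show ?thesis using nonneg[of t] by simp
qed

text \<open>An energy argument: the sum \<open>E\<close> of the squared derivatives below order
  \<open>degree p\<close> satisfies \<open>\<bar>E'\<bar> \<le> K * E\<close>, so it vanishes
  everywhere once it vanishes at \<open>a\<close>.\<close>

lemma linear_ode_unique:
  fixes f :: "real \<Rightarrow> real"
  assumes f: "smooth f" and p: "p \<noteq> 0" and ode: "\<And>t. poly_op p f t = 0"
    and init: "\<And>k. k \<le> degree p \<Longrightarrow> (ddt ^^ k) f a = 0"
  shows "f t = 0"
proof -
  let ?n = "degree p"
  let ?d = "\<lambda>k t. (ddt ^^ k) f t"
  define c where "c k = - coeff p k / lead_coeff p" for k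
  have top: "?d ?n t = (\<Sum>k<?n. c k * ?d k t)" for t
  proof -
    have "(\<Sum>k<?n. coeff p k * ?d k t) + lead_coeff p * ?d ?n t = 0"
      using ode[of t] by (simp add: poly_op_def flip: lessThan_Suc_atMost)
    then have "?d ?n t = - (\<Sum>k<?n. coeff p k * ?d k t) / lead_coeff p"
      using p by (simp add: field_simps)
    also have "\<dots> = (\<Sum>k<?n. c k * ?d k t)"
      by (simp add: c_def sum_divide_distrib sum_negf)
    finally show ?thesis .
  qed
  define E where "E t = (\<Sum>k<?n. (?d k t)\<^sup>2)" for t
  \<comment> \<open>Cauchy-Schwarz bounds the squared top derivative by the sum in \<open>C\<close>
    times \<open>E\<close>; the extra \<open>1\<close> lets \<open>C\<close> serve for the lower
    orders as well.\<close>
  define C where "C = 1 + (\<Sum>k<?n. (c k)\<^sup>2)"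
  have C: "1 \<le> C" by (simp add: C_def sum_nonneg)
  have E0: "0 \<le> E t" for t by (simp add: E_def sum_nonneg)
  have below: "(?d k t)\<^sup>2 \<le> E t" if "k < ?n" for k t
    unfolding E_def using that by (intro member_le_sum) auto
  have upto: "(?d k t)\<^sup>2 \<le> C * E t" if "k \<le> ?n" for k t
  proof (cases "k = ?n")
    case True
    have "(?d ?n t)\<^sup>2 \<le> (\<Sum>k<?n. (c k)\<^sup>2) * E t"
      unfolding top E_def by (rule Cauchy_Schwarz_ineq_sum)
    also have "\<dots> \<le> C * E t"
      using E0 by (intro mult_right_mono) (auto simp: C_def)
    finally show ?thesis using True by simp
  next
    case False
    then have "(?d k t)\<^sup>2 \<le> E t" using that by (intro below) simp
    also have "\<dots> \<le> C * E t"
      using mult_right_mono[OF C E0[of t]] by simp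
    finally show ?thesis .
  qed
  have dE: "(E has_real_derivative (\<Sum>k<?n. 2 * ?d k t * ?d (Suc k) t)) (at t)" for t
    unfolding E_def
    using smooth_has_vector_derivative[OF f, folded has_real_derivative_iff_has_vector_derivative]
    by (auto intro!: derivative_eq_intros sum.cong)
  have bd: "\<bar>\<Sum>k<?n. 2 * ?d k t * ?d (Suc k) t\<bar> \<le> (real ?n * (1 + C)) * E t" for t
  proof -
    have "\<bar>2 * ?d k t * ?d (Suc k) t\<bar> \<le> (1 + C) * E t" if "k < ?n" for k
    proof -
      have "\<bar>2 * x * y\<bar> \<le> x\<^sup>2 + y\<^sup>2" for x y :: real
        using sum_squares_bound[of x y] sum_squares_bound[of x "- y"] by (simp add: abs_le_iff)
      then have "\<bar>2 * ?d k t * ?d (Suc k) t\<bar> \<le> (?d k t)\<^sup>2 + (?d (Suc k) t)\<^sup>2" .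
      also have "\<dots> \<le> E t + C * E t"
        using below[OF that, of t] upto[of "Suc k" t] that by linarith
      finally show ?thesis by (simp add: algebra_simps)
    qed
    then have "(\<Sum>k<?n. \<bar>2 * ?d k t * ?d (Suc k) t\<bar>) \<le> real (card {..<?n}) * ((1 + C) * E t)"
      by (intro sum_bounded_above) auto
    then show ?thesis
      using order_trans[OF sum_abs] by (simp add: mult.assoc)
  qed
  have "E a = 0" using init by (simp add: E_def)
  from differential_inequality_zero[OF dE bd E0 this] have "E t = 0" .
  then have z: "?d k t = 0" if "k < ?n" for k
    using that by (simp add: E_def sum_nonneg_eq_0_iff)
  show ?thesis
  \<comment> \<open>For degree zero \<open>E\<close> is an empty sum and says nothing about
    \<open>f\<close>; there \<open>top\<close> itself reads \<open>f t = 0\<close>.\<close>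
  proof (cases "?n = 0")
    case True
    then show ?thesis using top[of t] by simp
  next
    case False
    then show ?thesis using z[of 0] by simp
  qed
qed

subsection \<open>Finite-dimensional behaviors\<close>

text \<open>Induction on \<open>J\<close>: a functional that vanishes on \<open>B\<close> gets the
  zero signal; otherwise its kernel is treated first and one element is added. The family spans
  \<open>B\<close> but need not be a dual basis, so arbitrary coefficients are not functional values
  in general.\<close>

lemma dual_family:
  fixes \<phi> :: "'j \<Rightarrow> ('a \<Rightarrow> 'b::real_vector) \<Rightarrow> real"
  assumes "finite J" and "(\<lambda>t. 0) \<in> B"
    and "\<And>v w c. v \<in> B \<Longrightarrow> w \<in> B \<Longrightarrow> (\<lambda>t. v t + c *\<^sub>R w t) \<in> B"
    and "\<And>j v w c. j \<in> J \<Longrightarrow> v \<in> B \<Longrightarrow> w \<in> B \<Longrightarrow> \<phi> j (\<lambda>t. v t + c *\<^sub>R w t) = \<phi> j v + c * \<phi> j w"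
    and "\<And>w. w \<in> B \<Longrightarrow> (\<And>j. j \<in> J \<Longrightarrow> \<phi> j w = 0) \<Longrightarrow> w = (\<lambda>t. 0)"
  shows "\<exists>g. (\<forall>j\<in>J. g j \<in> B) \<and> (\<forall>w\<in>B. w = (\<lambda>t. \<Sum>j\<in>J. \<phi> j w *\<^sub>R g j t))"
  using assms
proof (induction J arbitrary: B rule: finite_induct)
  case empty
  then show ?case by force
next
  case (insert x J)
  note lin = insert.prems(3)
  show ?case
  proof (cases "\<forall>w\<in>B. \<phi> x w = 0")
    case True
    have "\<exists>g. (\<forall>j\<in>J. g j \<in> B) \<and> (\<forall>w\<in>B. w = (\<lambda>t. \<Sum>j\<in>J. \<phi> j w *\<^sub>R g j t))"
    proof (rule insert.IH)
      show "w = (\<lambda>t. 0)" if "w \<in> B" "\<And>j. j \<in> J \<Longrightarrow> \<phi> j w = 0" for w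
        using that True insert.prems(4)[of w] by blast
    qed (use insert.prems(1-3) in auto)
    then obtain g where g: "\<forall>j\<in>J. g j \<in> B" "\<forall>w\<in>B. w = (\<lambda>t. \<Sum>j\<in>J. \<phi> j w *\<^sub>R g j t)" by blast
    let ?g = "g(x := \<lambda>t. 0)"
    have "(\<Sum>j\<in>J. \<phi> j w *\<^sub>R ?g j t) = (\<Sum>j\<in>J. \<phi> j w *\<^sub>R g j t)" for w t
      using insert.hyps by (intro sum.cong) auto
    then have "(\<forall>j\<in>insert x J. ?g j \<in> B) \<and> (\<forall>w\<in>B. w = (\<lambda>t. \<Sum>j\<in>insert x J. \<phi> j w *\<^sub>R ?g j t))"
      using g insert.hyps insert.prems(1) by auto
    then show ?thesis by blast
  next
    case False
    then obtain e where e: "e \<in> B" "\<phi> x e \<noteq> 0" by blast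
    let ?B = "{w \<in> B. \<phi> x w = 0}"
    have \<phi>0: "\<phi> j (\<lambda>t. 0) = 0" if "j \<in> insert x J" for j
      using lin[OF that insert.prems(1) insert.prems(1), of 1] by simp
    have "\<exists>g. (\<forall>j\<in>J. g j \<in> ?B) \<and> (\<forall>w\<in>?B. w = (\<lambda>t. \<Sum>j\<in>J. \<phi> j w *\<^sub>R g j t))"
    proof (rule insert.IH)
      show "(\<lambda>t. 0) \<in> ?B" using insert.prems(1) \<phi>0 by simp
      show "(\<lambda>t. v t + c *\<^sub>R w t) \<in> ?B" if "v \<in> ?B" "w \<in> ?B" for v w c
        using that insert.prems(2) lin by simp
      show "\<phi> j (\<lambda>t. v t + c *\<^sub>R w t) = \<phi> j v + c * \<phi> j w"
        if "j \<in> J" "v \<in> ?B" "w \<in> ?B" for j v w c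
        using that lin by simp
      show "w = (\<lambda>t. 0)" if "w \<in> ?B" "\<And>j. j \<in> J \<Longrightarrow> \<phi> j w = 0" for w
        using that insert.prems(4)[of w] by blast
    qed
    then obtain g where g: "\<And>j. j \<in> J \<Longrightarrow> g j \<in> B"
        "\<And>w. w \<in> ?B \<Longrightarrow> w = (\<lambda>t. \<Sum>j\<in>J. \<phi> j w *\<^sub>R g j t)" by blast
    \<comment> \<open>What the expansion of \<open>e\<close> over \<open>J\<close> misses, scaled by
      \<open>1 / \<phi> x e\<close>; it carries the coefficient \<open>\<phi> x w\<close>.\<close>
    define h where "h = (\<lambda>t. (1 / \<phi> x e) *\<^sub>R (e t - (\<Sum>j\<in>J. \<phi> j e *\<^sub>R g j t)))"
    have "(\<lambda>t. \<Sum>j\<in>K. a j *\<^sub>R g j t) \<in> B" if "K \<subseteq> J" for K a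
      using finite_subset[OF that \<open>finite J\<close>] that
    proof (induction K rule: finite_induct)
      case empty
      then show ?case using insert.prems(1) by simp
    next
      case (insert k K)
      then show ?case
        using \<open>\<And>v w c. v \<in> B \<Longrightarrow> w \<in> B \<Longrightarrow> (\<lambda>t. v t + c *\<^sub>R w t) \<in> B\<close>
          [of "\<lambda>t. \<Sum>j\<in>K. a j *\<^sub>R g j t" "g k" "a k"] g(1)
        by (simp add: add.commute)
    qed
    from insert.prems(2)[OF e(1) this[OF subset_refl], of "- 1"]
    have "(\<lambda>t. e t - (\<Sum>j\<in>J. \<phi> j e *\<^sub>R g j t)) \<in> B" by simp
    from insert.prems(2)[OF insert.prems(1) this, of "1 / \<phi> x e"]
    have h: "h \<in> B" by (simp add: h_def)
    let ?g = "g(x := h)"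
    have "w = (\<lambda>t. \<Sum>j\<in>insert x J. \<phi> j w *\<^sub>R ?g j t)" if w: "w \<in> B" for w
    proof
      fix t
      \<comment> \<open>The multiple of \<open>e\<close> that moves \<open>w\<close> into the kernel
        of \<open>\<phi> x\<close>, where the induction hypothesis applies.\<close>
      define a where "a = - (\<phi> x w / \<phi> x e)"
      let ?w = "\<lambda>t. w t + a *\<^sub>R e t"
      have "?w \<in> ?B"
        using insert.prems(2)[OF w e(1), of a] lin[OF _ w e(1), of x a] e(2) by (simp add: a_def)
      then have "?w = (\<lambda>t. \<Sum>j\<in>J. \<phi> j ?w *\<^sub>R g j t)" by (rule g(2))
      then have "w t + a *\<^sub>R e t = (\<Sum>j\<in>J. \<phi> j ?w *\<^sub>R g j t)" by (rule fun_cong)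
      also have "\<dots> = (\<Sum>j\<in>J. \<phi> j w *\<^sub>R g j t) + a *\<^sub>R (\<Sum>j\<in>J. \<phi> j e *\<^sub>R g j t)"
        using lin[OF _ w e(1)]
        by (simp add: scaleR_sum_right scaleR_add_left sum.distrib)
      finally have "w t = (\<Sum>j\<in>J. \<phi> j w *\<^sub>R g j t) - a *\<^sub>R (e t - (\<Sum>j\<in>J. \<phi> j e *\<^sub>R g j t))"
        by (simp add: algebra_simps)
      also have "\<dots> = (\<Sum>j\<in>J. \<phi> j w *\<^sub>R g j t) + \<phi> x w *\<^sub>R h t"
        by (simp add: a_def h_def)
      also have "(\<Sum>j\<in>J. \<phi> j w *\<^sub>R g j t) = (\<Sum>j\<in>J. \<phi> j w *\<^sub>R ?g j t)"
        using insert.hyps by (intro sum.cong) auto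
      finally show "w t = (\<Sum>j\<in>insert x J. \<phi> j w *\<^sub>R ?g j t)"
        using insert.hyps by (simp add: add.commute)
    qed
    moreover have "\<forall>j\<in>insert x J. ?g j \<in> B" using g(1) h by auto
    ultimately show ?thesis by blast
  qed
qed

text \<open>Bolzano-Weierstrass one index at a time; each further subsequence preserves the limits
  already obtained.\<close>

lemma convergent_subsequence_finite:
  fixes x :: "nat \<Rightarrow> 'j \<Rightarrow> real"
  assumes "finite J" and "\<And>j. j \<in> J \<Longrightarrow> bounded (range (\<lambda>n. x n j))"
  obtains r y where "strict_mono (r :: nat \<Rightarrow> nat)"
    and "\<And>j. j \<in> J \<Longrightarrow> (\<lambda>n. x (r n) j) \<longlonglongrightarrow> y j"
proof -
  have "\<exists>r y. strict_mono (r :: nat \<Rightarrow> nat) \<and> (\<forall>j\<in>J. (\<lambda>n. x (r n) j) \<longlonglongrightarrow> y j)"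
    using assms
  proof (induction J rule: finite_induct)
    case empty
    show ?case by (intro exI[of _ id]) (simp add: strict_mono_def)
  next
    case (insert k J)
    then obtain r y where r: "strict_mono (r :: nat \<Rightarrow> nat)"
      and y: "\<And>j. j \<in> J \<Longrightarrow> (\<lambda>n. x (r n) j) \<longlonglongrightarrow> y j" by auto
    have "bounded (range (\<lambda>n. x n k))" using insert.prems by simp
    then have "bounded (range (\<lambda>n. x (r n) k))" by (rule bounded_subset) auto
    from bounded_imp_convergent_subsequence[OF this] obtain l r'
      where r': "strict_mono r'" and l: "((\<lambda>n. x (r n) k) \<circ> r') \<longlonglongrightarrow> l" by blast
    have "(\<lambda>n. x ((r \<circ> r') n) j) \<longlonglongrightarrow> (y(k := l)) j" if "j \<in> insert k J" for j
    proof (cases "j = k")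
      case True
      then show ?thesis using l by (simp add: o_def)
    next
      case False
      then have "(\<lambda>n. x (r n) j) \<longlonglongrightarrow> y j" using that y by blast
      from LIMSEQ_subseq_LIMSEQ[OF this r'] show ?thesis using False by (simp add: o_def)
    qed
    then show ?case using strict_mono_o[OF r r'] by blast
  qed
  then show ?thesis using that by blast
qed

section \<open>Jets as finitely many coordinates\<close>

definition jet :: "nat \<times> 'q \<Rightarrow> 'q::finite signal \<Rightarrow> real \<Rightarrow> real" where
  "jet j w t = (ddt ^^ fst j) w t $ snd j"

lemma
  shows jet_shift: "smooth w \<Longrightarrow> jet j (\<lambda>t. w (t + s)) t = jet j w (t + s)"
    and jet_add: "smooth v \<Longrightarrow> smooth w \<Longrightarrow> jet j (\<lambda>t. v t + w t) t = jet j v t + jet j w t"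
    and jet_scaleR: "smooth w \<Longrightarrow> jet j (\<lambda>t. c *\<^sub>R w t) t = c * jet j w t"
    and jet_zero: "jet j (\<lambda>t. 0) t = 0"
  by (simp_all add: jet_def funpow_ddt_shift funpow_ddt_add funpow_ddt_scaleR funpow_ddt_zero)

lemma jet_sum:
  assumes "finite I" and "\<And>i. i \<in> I \<Longrightarrow> smooth (g i)"
  shows "jet j (\<lambda>t. \<Sum>i\<in>I. x i *\<^sub>R g i t) s = (\<Sum>i\<in>I. x i * jet j (g i) s)"
  using assms by (simp add: jet_def funpow_ddt_sum smooth_scaleR funpow_ddt_scaleR)

text \<open>Constant-coefficient operators commute with differentiation, so every derivative of a
  component inherits the scalar equation.\<close>

lemma poly_op_jet:
  assumes w: "smooth w" and ode: "\<And>i t. poly_op p (\<lambda>t. w t $ i) t = 0"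
  shows "smooth (jet j w)" and "poly_op p (jet j w) t = 0"
proof -
  let ?f = "\<lambda>t. w t $ snd j"
  have jet: "jet j w = (ddt ^^ fst j) ?f"
    using w by (simp add: jet_def funpow_ddt_component fun_eq_iff)
  have f: "smooth ?f" by (rule smooth_component[OF w])
  have "smooth ((ddt ^^ k) ?f) \<and> (\<forall>t. poly_op p ((ddt ^^ k) ?f) t = 0)" for k
  proof (induction k)
    case 0
    then show ?case using f ode by simp
  next
    case (Suc k)
    let ?g = "(ddt ^^ k) ?f"
    have "poly_op p ?g = (\<lambda>t. 0)" using Suc by auto
    then have "poly_op (pCons 0 p) ?g t = 0" for t
      using poly_op_has_vector_derivative[of ?g p t] Suc has_vector_derivative_const
        vector_derivative_unique_at by metis
    moreover have "poly_op (pCons 0 p) ?g t = poly_op p (ddt ?g) t" for t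
      using degree_pCons_le[of 0 p]
      by (subst poly_op_upto[of _ "Suc (degree p)"])
        (simp_all add: poly_op_def sum.atMost_Suc_shift funpow_Suc_right del: sum.atMost_Suc funpow.simps)
    ultimately show ?case using Suc smooth_ddt by auto
  qed
  then show "smooth (jet j w)" "poly_op p (jet j w) t = 0" unfolding jet by auto
qed

lemma poly_op_sum:
  assumes "finite I" and "\<And>i. i \<in> I \<Longrightarrow> smooth (f i)"
  shows "poly_op p (\<lambda>t. \<Sum>i\<in>I. c i * f i t) t = (\<Sum>i\<in>I. c i * poly_op p (f i) t)"
proof -
  note real_scaleR = smooth_scaleR[where 'a = real, unfolded real_scaleR_def]
    funpow_ddt_scaleR[where 'a = real, unfolded real_scaleR_def]
  have "(ddt ^^ k) (\<lambda>t. \<Sum>i\<in>I. c i * f i t) = (\<lambda>t. \<Sum>i\<in>I. c i * (ddt ^^ k) (f i) t)" for k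
    using assms by (simp add: funpow_ddt_sum real_scaleR)
  then have "poly_op p (\<lambda>t. \<Sum>i\<in>I. c i * f i t) t =
      (\<Sum>k\<le>degree p. \<Sum>i\<in>I. c i * (coeff p k * (ddt ^^ k) (f i) t))"
    by (simp add: poly_op_def sum_distrib_left algebra_simps)
  also have "\<dots> = (\<Sum>i\<in>I. c i * poly_op p (f i) t)"
    by (subst sum.swap) (simp add: poly_op_def sum_distrib_left)
  finally show ?thesis .
qed

text \<open>Supplies zero initial data: a signal that vanishes on an open half line has all
  derivatives zero at a point inside it, where uniqueness or an expansion can start.\<close>

lemma funpow_ddt_zero_on_open:
  assumes "open S" and "\<And>t. t \<in> S \<Longrightarrow> f t = 0"
  shows "t \<in> S \<Longrightarrow> (ddt ^^ k) f t = 0"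
proof (induction k arbitrary: t)
  case 0
  then show ?case using assms by simp
next
  case (Suc k)
  have "((ddt ^^ k) f has_vector_derivative 0) (at t)"
    by (rule has_vector_derivative_transform_within_open[of "\<lambda>t. 0" _ _ S])
      (use Suc assms(1) in auto)
  from vector_derivative_at[OF this] show ?case by (simp add: ddt_def[of "(ddt ^^ k) f"])
qed

text \<open>Initial data at \<open>0\<close> are linear functionals that separate solutions, so
  \<open>dual_family\<close> gives the expansion. The last property is unique continuation:
  combinations of jets solve the same scalar equation, so vanishing at nonnegative times spreads to
  all times.\<close>

lemma kernel_behavior_jet_basis:
  fixes R :: "(real ^ 'q::finite) poly list"
  assumes "\<And>v. (\<lambda>t. exp t *\<^sub>R v) \<in> kernel_behavior R \<Longrightarrow> v = 0"
  obtains J g where "finite J" and "\<And>i. (0, i) \<in> J"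
    and "\<And>j. j \<in> J \<Longrightarrow> g j \<in> kernel_behavior R"
    and "\<And>w. w \<in> kernel_behavior R \<Longrightarrow> w = (\<lambda>t. \<Sum>j\<in>J. jet j w 0 *\<^sub>R g j t)"
    and "\<And>w c t. w \<in> kernel_behavior R \<Longrightarrow> (\<And>t. t \<ge> 0 \<Longrightarrow> (\<Sum>j\<in>J. c j * jet j w t) = 0) \<Longrightarrow>
      (\<Sum>j\<in>J. c j * jet j w t) = 0"
proof -
  obtain p where p: "p \<noteq> 0"
    and ode: "\<And>w i t. w \<in> kernel_behavior R \<Longrightarrow> poly_op p (\<lambda>t. w t $ i) t = 0"
    using kernel_behavior_scalar_equation[OF assms] by metis
  \<comment> \<open>The orders run through \<open>degree p\<close> inclusive, matching the initial
    conditions of \<open>linear_ode_unique\<close>; order \<open>0\<close> is then present even for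
    constant \<open>p\<close>.\<close>
  define J where "J = {..degree p} \<times> (UNIV :: 'q set)"
  have J: "finite J" by (simp add: J_def)
  have inj: "w = (\<lambda>t. 0)" if w: "w \<in> kernel_behavior R" and z: "\<And>j. j \<in> J \<Longrightarrow> jet j w 0 = 0" for w
  proof -
    have sw: "smooth w" using w by (rule kernel_behavior_smooth)
    have "w t $ i = 0" for t i
    proof (rule linear_ode_unique[OF smooth_component[OF sw] p ode[OF w], of _ 0])
      fix k assume "k \<le> degree p"
      then show "(ddt ^^ k) (\<lambda>t. w t $ i) 0 = 0"
        using z[of "(k, i)"] sw by (simp add: J_def jet_def funpow_ddt_component)
    qed
    then show ?thesis by (simp add: vec_eq_iff fun_eq_iff)
  qed
  have "\<exists>g. (\<forall>j\<in>J. g j \<in> kernel_behavior R) \<and>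
      (\<forall>w\<in>kernel_behavior R. w = (\<lambda>t. \<Sum>j\<in>J. jet j w 0 *\<^sub>R g j t))"
  proof (rule dual_family[OF J kernel_behavior_zero])
    show "w = (\<lambda>t. 0)"
      if "w \<in> kernel_behavior R" "\<And>j. j \<in> J \<Longrightarrow> jet j w 0 = 0" for w
      using inj that .
  qed (auto intro: kernel_behavior_add kernel_behavior_scaleR kernel_behavior_smooth
      simp: jet_add jet_scaleR smooth_scaleR kernel_behavior_smooth)
  then obtain g where g: "\<And>j. j \<in> J \<Longrightarrow> g j \<in> kernel_behavior R"
    "\<And>w. w \<in> kernel_behavior R \<Longrightarrow> w = (\<lambda>t. \<Sum>j\<in>J. jet j w 0 *\<^sub>R g j t)" by blast
  have "(\<Sum>j\<in>J. c j * jet j w t) = 0"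
    if w: "w \<in> kernel_behavior R" and z: "\<And>t. t \<ge> 0 \<Longrightarrow> (\<Sum>j\<in>J. c j * jet j w t) = 0" for w c t
  proof -
    let ?f = "\<lambda>t. \<Sum>j\<in>J. c j * jet j w t"
    note sj = poly_op_jet[OF kernel_behavior_smooth[OF w] ode[OF w]]
    have "smooth (\<lambda>t. \<Sum>j\<in>J. c j *\<^sub>R jet j w t)"
      by (intro smooth_sum J smooth_scaleR sj)
    then have "smooth ?f" by simp
    moreover have "poly_op p ?f t = 0" for t
      by (simp add: poly_op_sum[OF J sj(1)] sj(2))
    \<comment> \<open>Time \<open>1\<close> has a neighbourhood inside the half line of known zeros,
      which \<open>0\<close> lacks.\<close>
    moreover have "(ddt ^^ k) ?f 1 = 0" for k
      by (rule funpow_ddt_zero_on_open[of "{0<..}"]) (auto simp: z)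
    ultimately show ?thesis
      using linear_ode_unique[OF _ p, of ?f 1] by blast
  qed
  then show ?thesis
    by (intro that[OF J _ g]) (simp_all add: J_def)
qed

lemma norm_vec_le_component_bound:
  fixes x :: "real ^ 'n" and M :: real
  assumes "\<And>i. \<bar>x $ i\<bar> \<le> M"
  shows "norm x \<le> CARD('n) * M"
proof -
  have "norm x \<le> (\<Sum>i\<in>UNIV. \<bar>x $ i\<bar>)" by (rule norm_le_l1_cart)
  also have "\<dots> \<le> CARD('n) * M" using assms by (intro sum_bounded_above) auto
  finally show ?thesis .
qed

subsection \<open>Lyapunov forms\<close>

text \<open>The diagonal of \<open>b\<close> is the Lyapunov function \<open>V\<close>; the bilinear
  form is kept for expansions and polarization. The assumption \<open>definite\<close> speaks of all
  times jointly; definiteness at a single time is derived below.\<close>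

locale lyapunov_form =
  fixes R :: "(real ^ 'q::finite) poly list"
    and b :: "'q signal \<Rightarrow> 'q signal \<Rightarrow> real \<Rightarrow> real"
  assumes add_left: "smooth u \<Longrightarrow> smooth v \<Longrightarrow> smooth w \<Longrightarrow>
      b (\<lambda>t. u t + v t) w s = b u w s + b v w s"
    and add_right: "smooth u \<Longrightarrow> smooth v \<Longrightarrow> smooth w \<Longrightarrow>
      b w (\<lambda>t. u t + v t) s = b w u s + b w v s"
    and scaleR_left: "smooth v \<Longrightarrow> smooth w \<Longrightarrow> b (\<lambda>t. c *\<^sub>R v t) w s = c * b v w s"
    and scaleR_right: "smooth v \<Longrightarrow> smooth w \<Longrightarrow> b w (\<lambda>t. c *\<^sub>R v t) s = c * b w v s"
    and shift: "smooth v \<Longrightarrow> smooth w \<Longrightarrow> b (\<lambda>t. v (t + a)) (\<lambda>t. w (t + a)) s = b v w (s + a)"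
    and nonneg: "w \<in> kernel_behavior R \<Longrightarrow> 0 \<le> b w w t"
    and decreasing: "w \<in> kernel_behavior R \<Longrightarrow> s \<le> t \<Longrightarrow> b w w t \<le> b w w s"
    and definite: "w \<in> kernel_behavior R \<Longrightarrow> (\<And>t. b w w t = 0) \<Longrightarrow> w = (\<lambda>t. 0)"
begin

abbreviation "B \<equiv> kernel_behavior R"

lemmas B_smooth = kernel_behavior_smooth[of _ R]

lemma b_zero_left: "smooth w \<Longrightarrow> b (\<lambda>t. 0) w s = 0"
  using scaleR_left[OF smooth_zero, of w 0 s] by simp

lemma b_zero_right: "smooth w \<Longrightarrow> b w (\<lambda>t. 0) s = 0"
  using scaleR_right[OF smooth_zero, of w 0 s] by simp

lemma b_sum_left:
  assumes "finite I" and "\<And>i. i \<in> I \<Longrightarrow> smooth (g i)" and "smooth w"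
  shows "b (\<lambda>t. \<Sum>i\<in>I. x i *\<^sub>R g i t) w s = (\<Sum>i\<in>I. x i * b (g i) w s)"
  using assms
  by (induction I rule: finite_induct)
    (auto simp: b_zero_left add_left scaleR_left smooth_scaleR smooth_sum)

lemma b_sum_right:
  assumes "finite I" and "\<And>i. i \<in> I \<Longrightarrow> smooth (g i)" and "smooth w"
  shows "b w (\<lambda>t. \<Sum>i\<in>I. x i *\<^sub>R g i t) s = (\<Sum>i\<in>I. x i * b w (g i) s)"
  using assms
  by (induction I rule: finite_induct)
    (auto simp: b_zero_right add_right scaleR_right smooth_scaleR smooth_sum)

text \<open>Along an exponential solution the form grows by the factor \<open>exp (2 t)\<close>, which is
  compatible with being nonnegative and decreasing only if it vanishes.\<close>
lemma no_exponential_solution: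
  assumes w: "(\<lambda>t. exp t *\<^sub>R v) \<in> B"
  shows "v = 0"
proof -
  let ?w = "\<lambda>t. exp t *\<^sub>R v"
  have sw: "smooth ?w" by (rule smooth_exp)
  have "b ?w ?w s = (exp s)\<^sup>2 * b ?w ?w 0" for s
  proof -
    have "(\<lambda>t. exp (t + s) *\<^sub>R v) = (\<lambda>t. exp s *\<^sub>R ?w t)"
      by (simp add: exp_add mult.commute)
    then show ?thesis
      using shift[OF sw sw, of s 0] scaleR_left[OF sw smooth_scaleR[OF sw], of "exp s" "exp s" 0]
        scaleR_right[OF sw sw, of "exp s" 0]
      by (simp add: power2_eq_square)
  qed
  note growth = this
  have "b ?w ?w 0 = 0"
  proof (rule ccontr)
    assume "b ?w ?w 0 \<noteq> 0"
    then have pos: "b ?w ?w 0 > 0" using nonneg[OF w, of 0] by simp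
    have "(1::real) < (exp 1)\<^sup>2" by (simp add: one_less_power)
    then have "1 * b ?w ?w 0 < (exp 1)\<^sup>2 * b ?w ?w 0"
      using pos by (rule mult_strict_right_mono)
    then show False
      using growth[of 1] decreasing[OF w, of 0 1] by simp
  qed
  then have "b ?w ?w s = 0" for s using growth[of s] by simp
  then have "?w = (\<lambda>t. 0)" by (rule definite[OF w])
  then have "exp 0 *\<^sub>R v = 0" by (rule fun_cong)
  then show ?thesis by simp
qed

end

text \<open>Fixes the coordinates \<open>J\<close> and the spanning signals \<open>g\<close> for the
  arguments that follow; their existence comes from the absence of exponential solutions.\<close>

locale lyapunov_form_basis = lyapunov_form R b
  for R :: "(real ^ 'q::finite) poly list" and b +
  fixes J :: "(nat \<times> 'q) set" and g :: "nat \<times> 'q \<Rightarrow> 'q signal"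
  assumes J: "finite J" and J0: "(0, i) \<in> J"
    and g: "j \<in> J \<Longrightarrow> g j \<in> B"
    and rep: "w \<in> B \<Longrightarrow> w = (\<lambda>t. \<Sum>j\<in>J. jet j w 0 *\<^sub>R g j t)"
    and unique: "w \<in> B \<Longrightarrow> (\<And>t. t \<ge> 0 \<Longrightarrow> (\<Sum>j\<in>J. c j * jet j w t) = 0) \<Longrightarrow>
      (\<Sum>j\<in>J. c j * jet j w t) = 0"
begin

text \<open>The difference vanishes near time \<open>-1\<close>, so shifting that time to
  \<open>0\<close> makes all coefficients of its expansion zero.\<close>

lemma autonomous: "autonomous_behavior B"
  unfolding autonomous_behavior_def
proof (intro ballI impI)
  fix w1 w2 assume w: "w1 \<in> B" "w2 \<in> B" and eq: "\<forall>t<0. w1 t = w2 t"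
  let ?d = "\<lambda>t. w1 t + (- 1) *\<^sub>R w2 t"
  have d: "?d \<in> B" using w by (intro kernel_behavior_add kernel_behavior_scaleR)
  have "(ddt ^^ k) ?d (- 1) = 0" for k
    by (rule funpow_ddt_zero_on_open[of "{..<0}"]) (use eq in auto)
  then have "jet j (\<lambda>t. ?d (t + - 1)) 0 = 0" for j
    unfolding jet_shift[OF B_smooth[OF d]] by (simp add: jet_def)
  then have zero: "(\<lambda>t. ?d (t + - 1)) = (\<lambda>t. 0)"
    by (subst rep[OF kernel_behavior_shift[OF d, of "- 1"]]) simp
  have "?d ((t + 1) + - 1) = 0" for t using zero by (rule fun_cong)
  then show "w1 = w2" by (simp add: fun_eq_iff)
qed

text \<open>A null vector of the form stays null under forward shifts, hence is orthogonal to \<open>B\<close> at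
  all nonnegative times; by uniqueness for linear differential equations this extends to
  negative times.\<close>
lemma definite_at_0:
  assumes w: "w \<in> B" and null: "b w w 0 = 0"
  shows "w = (\<lambda>t. 0)"
proof (rule definite[OF w])
  define S where "S s = (\<lambda>t. w (t + s))" for s
  have S: "S s \<in> B" for s unfolding S_def by (rule kernel_behavior_shift[OF w])
  \<comment> \<open>A null vector of a nonnegative quadratic form lies in its radical; the polar
    form of \<open>b\<close> is \<open>b v w + b w v\<close>.\<close>
  have polar0: "b (S s) v 0 + b v (S s) 0 = 0" if v: "v \<in> B" and "0 \<le> s" for v s
  proof (rule ccontr)
    let ?c = "b (S s) v 0 + b v (S s) 0"
    assume c: "?c \<noteq> 0"
    have "b (S s) (S s) 0 = b w w s"
      using shift[OF B_smooth[OF w] B_smooth[OF w], of s 0] by (simp add: S_def)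
    also have "\<dots> = 0"
      using decreasing[OF w \<open>0 \<le> s\<close>] nonneg[OF w, of s] null by simp
    finally have z: "b (S s) (S s) 0 = 0" .
    \<comment> \<open>The form at \<open>a *\<^sub>R S s + v\<close> is affine in \<open>a\<close>
      because \<open>S s\<close> is null; this \<open>a\<close> makes it \<open>- 1\<close>.\<close>
    define a where "a = - (b v v 0 + 1) / ?c"
    let ?u = "\<lambda>t. a *\<^sub>R S s t + v t"
    have "?u \<in> B" using S v by (intro kernel_behavior_add kernel_behavior_scaleR)
    then have "0 \<le> b ?u ?u 0" by (rule nonneg)
    also have "b ?u ?u 0 = a * ?c + b v v 0"
      using B_smooth[OF S, of s] B_smooth[OF v] z
      by (simp add: add_left add_right scaleR_left scaleR_right smooth_add smooth_scaleR algebra_simps)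
    also have "\<dots> = - 1" using c by (simp add: a_def)
    finally show False by simp
  qed
  \<comment> \<open>As a function of \<open>s\<close> the polar form is a combination of jets of
    \<open>w\<close>, so \<open>unique\<close> carries its vanishing over to negative
    \<open>s\<close>.\<close>
  have polar: "b (S s) v 0 + b v (S s) 0 = (\<Sum>j\<in>J. (b (g j) v 0 + b v (g j) 0) * jet j w s)"
    if v: "v \<in> B" for v s
  proof -
    have "jet j (S s) 0 = jet j w s" for j
      using jet_shift[OF B_smooth[OF w], of j s 0] by (simp add: S_def)
    then have "S s = (\<lambda>t. \<Sum>j\<in>J. jet j w s *\<^sub>R g j t)"
      by (subst rep[OF S, of s]) simp
    then show ?thesis
      by (simp add: b_sum_left[OF J B_smooth[OF g] B_smooth[OF v]]
          b_sum_right[OF J B_smooth[OF g] B_smooth[OF v]] sum.distrib algebra_simps)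
  qed
  fix t
  have "b (S t) v 0 + b v (S t) 0 = 0" if v: "v \<in> B" for v
    unfolding polar[OF v]
    by (rule unique[OF w], subst polar[OF v, symmetric], rule polar0[OF v])
  \<comment> \<open>With \<open>v\<close> equal to \<open>S t\<close> the polar form is twice the
    form itself.\<close>
  from this[OF S[of t]] have "b (S t) (S t) 0 = 0" by simp
  then show "b w w t = 0"
    using shift[OF B_smooth[OF w] B_smooth[OF w], of t 0] by (simp add: S_def)
qed

section \<open>The form in coordinates, and its coercivity\<close>

definition gram :: "(nat \<times> 'q \<Rightarrow> real) \<Rightarrow> real \<Rightarrow> real" where
  "gram x s = (\<Sum>i\<in>J. \<Sum>j\<in>J. x i * x j * b (g i) (g j) s)"

definition comb :: "(nat \<times> 'q \<Rightarrow> real) \<Rightarrow> 'q signal" where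
  "comb x = (\<lambda>t. \<Sum>j\<in>J. x j *\<^sub>R g j t)"

lemma comb_in: "comb x \<in> B"
  unfolding comb_def by (rule kernel_behavior_sum[OF J g])

lemma b_comb: "b (comb x) (comb x) s = gram x s"
  unfolding gram_def using B_smooth[OF comb_in, of x]
  by (subst (1) comb_def)
    (simp add: b_sum_left[OF J B_smooth[OF g]] comb_def b_sum_right[OF J B_smooth[OF g] B_smooth[OF g]]
      sum_distrib_left mult.assoc)

text \<open>The coordinates of the signal shifted by \<open>t\<close> are its jets at
  \<open>t\<close>. For each offset \<open>s\<close>, values along an orbit thus become a fixed
  polynomial in finitely many reals, through which limits pass.\<close>

lemma b_eq_gram:
  assumes w: "w \<in> B"
  shows "b w w (s + t) = gram (\<lambda>j. jet j w t) s"
proof -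
  let ?w = "\<lambda>u. w (u + t)"
  have "?w = comb (\<lambda>j. jet j w t)"
    using jet_shift[OF B_smooth[OF w]]
    by (subst rep[OF kernel_behavior_shift[OF w, of t]]) (simp add: comb_def)
  then show ?thesis
    using shift[OF B_smooth[OF w] B_smooth[OF w], of t s] b_comb by simp
qed

lemma gram_tendsto:
  assumes "\<And>j. j \<in> J \<Longrightarrow> ((\<lambda>n. x n j) \<longlongrightarrow> y j) F"
  shows "((\<lambda>n. gram (x n) s) \<longlongrightarrow> gram y s) F"
  unfolding gram_def using assms by (intro tendsto_intros) auto

text \<open>The \<open>g j\<close> need not be dual to the jets, so \<open>comb y\<close> has jets
  \<open>y\<close> only for consistent \<open>y\<close>. Consistency is a linear relation that the
  jets of every signal in \<open>B\<close> satisfy, and it survives the limit.\<close>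

lemma jet_comb_limit:
  assumes w: "\<And>n. w n \<in> B" and lim: "\<And>j. j \<in> J \<Longrightarrow> (\<lambda>n. jet j (w n) 0) \<longlonglongrightarrow> y j" and j: "j \<in> J"
  shows "jet j (comb y) 0 = y j"
proof -
  have "jet j (w n) 0 = (\<Sum>i\<in>J. jet i (w n) 0 * jet j (g i) 0)" for n
    using arg_cong[OF rep[OF w[of n]], of "\<lambda>v. jet j v 0"] jet_sum[OF J B_smooth[OF g]] by simp
  then have "(\<lambda>n. jet j (w n) 0) \<longlonglongrightarrow> (\<Sum>i\<in>J. y i * jet j (g i) 0)"
    using lim by (auto intro!: tendsto_intros)
  then have "y j = (\<Sum>i\<in>J. y i * jet j (g i) 0)"
    using lim[OF j] LIMSEQ_unique by blast
  then show ?thesis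
    unfolding comb_def using jet_sum[OF J B_smooth[OF g]] by simp
qed

text \<open>Compactness of the unit sphere in jet coordinates: normalized counterexamples would
  subconverge to a signal of jet norm \<open>1\<close> on which the form is zero at time
  \<open>0\<close>, against \<open>definite_at_0\<close>.\<close>

lemma coercive: "\<exists>\<kappa>. \<forall>w\<in>B. (\<Sum>j\<in>J. (jet j w 0)\<^sup>2) \<le> \<kappa> * b w w 0"
proof (rule ccontr)
  let ?S = "\<lambda>w. \<Sum>j\<in>J. (jet j w 0)\<^sup>2"
  assume "\<nexists>\<kappa>. \<forall>w\<in>B. ?S w \<le> \<kappa> * b w w 0"
  then have "\<forall>n. \<exists>w\<in>B. real (Suc n) * b w w 0 < ?S w" by (metis linorder_not_less)
  then obtain v where v: "\<And>n. v n \<in> B" "\<And>n. real (Suc n) * b (v n) (v n) 0 < ?S (v n)" by metis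
  have pos: "0 < ?S (v n)" for n
  proof -
    have "0 \<le> real (Suc n) * b (v n) (v n) 0" using nonneg[OF v(1)] by simp
    then show ?thesis using v(2)[of n] by linarith
  qed
  define w where "w n = (\<lambda>t. (1 / sqrt (?S (v n))) *\<^sub>R v n t)" for n
  have w: "w n \<in> B" for n unfolding w_def by (rule kernel_behavior_scaleR[OF v(1)])
  have "jet j (w n) 0 = jet j (v n) 0 / sqrt (?S (v n))" for j n
    unfolding w_def by (simp add: jet_scaleR[OF B_smooth[OF v(1)]])
  then have S1: "?S (w n) = 1" for n
    using pos[of n] by (simp add: power_divide flip: sum_divide_distrib)
  have "b (w n) (w n) 0 = b (v n) (v n) 0 / ?S (v n)" for n
    unfolding w_def using B_smooth[OF v(1)] pos[of n]
    by (simp add: scaleR_left scaleR_right smooth_scaleR)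
  then have small: "b (w n) (w n) 0 \<le> inverse (real (Suc n))" for n
    using v(2)[of n] pos[of n] by (simp add: field_simps)
  have le_1: "\<bar>jet j (w n) 0\<bar> \<le> 1" if "j \<in> J" for j n
  proof -
    have "(jet j (w n) 0)\<^sup>2 \<le> ?S (w n)" using J that by (intro member_le_sum) auto
    then show ?thesis using S1 by (simp add: abs_square_le_1)
  qed
  have "bounded (range (\<lambda>n. jet j (w n) 0))" if "j \<in> J" for j
    using le_1[OF that] by (intro boundedI[of _ 1]) auto
  from convergent_subsequence_finite[of J "\<lambda>n j. jet j (w n) 0", OF J this]
  obtain r y where r: "strict_mono (r :: nat \<Rightarrow> nat)"
    and y: "\<And>j. j \<in> J \<Longrightarrow> (\<lambda>n. jet j (w (r n)) 0) \<longlonglongrightarrow> y j" by blast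
  have "(\<lambda>n. ?S (w (r n))) \<longlonglongrightarrow> (\<Sum>j\<in>J. (y j)\<^sup>2)"
    using y by (intro tendsto_intros) auto
  then have "(\<Sum>j\<in>J. (y j)\<^sup>2) = 1"
    unfolding S1 using LIMSEQ_unique tendsto_const by blast
  moreover have "(\<lambda>n. gram (\<lambda>j. jet j (w (r n)) 0) 0) \<longlonglongrightarrow> gram y 0"
    by (rule gram_tendsto[OF y])
  then have "(\<lambda>n. b (w (r n)) (w (r n)) 0) \<longlonglongrightarrow> b (comb y) (comb y) 0"
    using b_eq_gram[OF w, of _ 0 0] by (simp add: b_comb)
  moreover have "(\<lambda>n. b (w (r n)) (w (r n)) 0) \<longlonglongrightarrow> 0"
  proof (rule tendsto_sandwich[OF _ _ tendsto_const])
    show "(\<lambda>n. inverse (real (Suc (r n)))) \<longlonglongrightarrow> 0"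
      using LIMSEQ_subseq_LIMSEQ[OF LIMSEQ_inverse_real_of_nat r] by (simp add: o_def)
  qed (use nonneg[OF w] small in auto)
  ultimately have "b (comb y) (comb y) 0 = 0" using LIMSEQ_unique by blast
  then have "comb y = (\<lambda>t. 0)" by (rule definite_at_0[OF comb_in])
  then have "y j = 0" if "j \<in> J" for j
    using jet_comb_limit[OF w y that] by (simp add: jet_zero)
  then show False using \<open>(\<Sum>j\<in>J. (y j)\<^sup>2) = 1\<close> by simp
qed

text \<open>Time invariance moves the estimate from \<open>0\<close> to any \<open>t\<close>.
  Passing to the absolute value makes the constant nonnegative, so that it can multiply the decrease
  of the form.\<close>

lemma jet_bound:
  obtains \<kappa> where "\<And>w j t. w \<in> B \<Longrightarrow> j \<in> J \<Longrightarrow> (jet j w t)\<^sup>2 \<le> \<kappa> * b w w t" and "0 \<le> \<kappa>"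
proof -
  obtain \<kappa> where \<kappa>: "\<And>w. w \<in> B \<Longrightarrow> (\<Sum>j\<in>J. (jet j w 0)\<^sup>2) \<le> \<kappa> * b w w 0"
    using coercive by blast
  have "(jet j w t)\<^sup>2 \<le> \<bar>\<kappa>\<bar> * b w w t" if w: "w \<in> B" and j: "j \<in> J" for w j t
  proof -
    let ?w = "\<lambda>u. w (u + t)"
    have "(jet j ?w 0)\<^sup>2 \<le> (\<Sum>j\<in>J. (jet j ?w 0)\<^sup>2)" using J j by (intro member_le_sum) auto
    also have "\<dots> \<le> \<kappa> * b ?w ?w 0" by (rule \<kappa>[OF kernel_behavior_shift[OF w]])
    finally have "(jet j w t)\<^sup>2 \<le> \<kappa> * b w w t"
      using shift[OF B_smooth[OF w] B_smooth[OF w], of t 0] jet_shift[OF B_smooth[OF w], of j t 0]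
      by simp
    also have "\<dots> \<le> \<bar>\<kappa>\<bar> * b w w t"
      using nonneg[OF w] by (intro mult_right_mono) auto
    finally show ?thesis .
  qed
  then show ?thesis by (rule that) auto
qed

lemma jet_bounded:
  assumes w: "w \<in> B"
  obtains M where "\<And>j t. j \<in> J \<Longrightarrow> 0 \<le> t \<Longrightarrow> \<bar>jet j w t\<bar> \<le> M"
proof -
  obtain \<kappa> where \<kappa>: "\<And>w j t. w \<in> B \<Longrightarrow> j \<in> J \<Longrightarrow> (jet j w t)\<^sup>2 \<le> \<kappa> * b w w t" "0 \<le> \<kappa>"
    using jet_bound by metis
  have "\<bar>jet j w t\<bar> \<le> sqrt (\<kappa> * b w w 0)" if "j \<in> J" "0 \<le> t" for j t
  proof (rule real_le_rsqrt[of "\<bar>_\<bar>", unfolded power2_abs])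
    show "(jet j w t)\<^sup>2 \<le> \<kappa> * b w w 0"
      using \<kappa>(1)[OF w that(1), of t] mult_left_mono[OF decreasing[OF w that(2)] \<kappa>(2)] by linarith
  qed
  then show ?thesis by (rule that)
qed

lemma component_eq_jet: "w t $ i = jet (0, i) w t"
  by (simp add: jet_def)

lemma stable: "stable_behavior B"
  unfolding stable_behavior_def
proof (intro conjI autonomous ballI)
  fix w assume "w \<in> B"
  then obtain M where "\<And>j t. j \<in> J \<Longrightarrow> 0 \<le> t \<Longrightarrow> \<bar>jet j w t\<bar> \<le> M"
    using jet_bounded by blast
  then have "norm (w t) \<le> CARD('q) * M" if "0 \<le> t" for t
    using that J0 by (intro norm_vec_le_component_bound) (simp add: component_eq_jet)
  then show "bounded (w ` {0..})" by (intro boundedI) auto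
qed

text \<open>LaSalle's invariance principle: the form is constant along any limit point of an orbit.\<close>
lemma asymptotically_stable:
  assumes const: "\<And>w. w \<in> B \<Longrightarrow> (\<And>t. b w w t = b w w 0) \<Longrightarrow> w = (\<lambda>t. 0)"
  shows "asymptotically_stable_behavior B"
  unfolding asymptotically_stable_behavior_def
proof (intro conjI autonomous ballI)
  fix w assume w: "w \<in> B"
  define V where "V t = b w w t" for t
  define c where "c = Inf (range V)"
  have bdd: "bdd_below (range V)" using nonneg[OF w] by (auto simp: V_def intro!: bdd_belowI)
  have V: "(V \<longlongrightarrow> c) at_top"
  proof (rule decreasing_tendsto)
    show "\<forall>\<^sub>F t in at_top. c \<le> V t"
      unfolding c_def using bdd by (intro always_eventually allI cInf_lower) auto
    fix x assume "c < x"
    then obtain a where "V a < x" unfolding c_def using bdd by (subst (asm) cInf_less_iff) auto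
    then have "V t < x" if "a \<le> t" for t
      using decreasing[OF w that] by (simp add: V_def)
    then show "\<forall>\<^sub>F t in at_top. V t < x" using eventually_at_top_linorder by blast
  qed
  obtain M where M: "\<And>j t. j \<in> J \<Longrightarrow> 0 \<le> t \<Longrightarrow> \<bar>jet j w t\<bar> \<le> M"
    using jet_bounded[OF w] by blast
  \<comment> \<open>The orbit is sampled at integer times; its jets are bounded, so a subsequence
    converges to limit coordinates \<open>y\<close>.\<close>
  define v where "v n = (\<lambda>t. w (t + real n))" for n
  have v: "v n \<in> B" for n unfolding v_def by (rule kernel_behavior_shift[OF w])
  have jet_v: "jet j (v n) 0 = jet j w (real n)" for j n
    using jet_shift[OF B_smooth[OF w], of j "real n" 0] by (simp add: v_def)
  have "bounded (range (\<lambda>n. jet j (v n) 0))" if "j \<in> J" for j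
    unfolding jet_v using M[OF that] by (intro boundedI[of _ M]) auto
  from convergent_subsequence_finite[of J "\<lambda>n j. jet j (v n) 0", OF J this]
  obtain r y where r: "strict_mono (r :: nat \<Rightarrow> nat)"
    and y: "\<And>j. j \<in> J \<Longrightarrow> (\<lambda>n. jet j (v (r n)) 0) \<longlonglongrightarrow> y j" by blast
  \<comment> \<open>For fixed \<open>s\<close> the values at \<open>s + real (r n)\<close> approach
    both the form along \<open>comb y\<close> at \<open>s\<close> and the limit \<open>c\<close> of
    \<open>V\<close>.\<close>
  have lim: "b (comb y) (comb y) s = c" for s
  proof -
    have "(\<lambda>n. gram (\<lambda>j. jet j (v (r n)) 0) s) \<longlonglongrightarrow> gram y s" by (rule gram_tendsto[OF y])
    then have "(\<lambda>n. V (s + real (r n))) \<longlonglongrightarrow> b (comb y) (comb y) s"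
      by (simp add: jet_v b_comb V_def b_eq_gram[OF w])
    moreover have "filterlim (\<lambda>n. s + real (r n)) at_top sequentially"
      by (intro filterlim_tendsto_add_at_top[OF tendsto_const]
          filterlim_compose[OF filterlim_real_sequentially filterlim_subseq[OF r]])
    then have "(\<lambda>n. V (s + real (r n))) \<longlonglongrightarrow> c" by (rule filterlim_compose[OF V])
    ultimately show ?thesis using LIMSEQ_unique by blast
  qed
  have "comb y = (\<lambda>t. 0)" by (rule const[OF comb_in]) (simp add: lim)
  then have "c = 0" using lim[of 0] by (simp add: b_zero_left smooth_zero)
  obtain \<kappa> where \<kappa>: "\<And>w j t. w \<in> B \<Longrightarrow> j \<in> J \<Longrightarrow> (jet j w t)\<^sup>2 \<le> \<kappa> * b w w t"
    using jet_bound by metis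
  show "(w \<longlongrightarrow> 0) at_top"
  proof (rule vec_tendstoI)
    fix i
    have "((\<lambda>t. (w t $ i)\<^sup>2) \<longlongrightarrow> 0) at_top"
    proof (rule tendsto_sandwich[OF _ _ tendsto_const])
      show "((\<lambda>t. \<kappa> * V t) \<longlongrightarrow> 0) at_top"
        using tendsto_mult_left[OF V, of \<kappa>] \<open>c = 0\<close> by simp
      show "\<forall>\<^sub>F t in at_top. (w t $ i)\<^sup>2 \<le> \<kappa> * V t"
        using \<kappa>[OF w J0] by (simp add: component_eq_jet V_def)
    qed simp
    then have "((\<lambda>t. sqrt ((w t $ i)\<^sup>2)) \<longlongrightarrow> sqrt 0) at_top" by (rule tendsto_real_sqrt)
    then show "((\<lambda>t. w t $ i) \<longlongrightarrow> 0 $ i) at_top" by (simp add: tendsto_rabs_zero_iff)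
  qed
qed

end

context lyapunov_form
begin

lemma basis_exists: "\<exists>J g. lyapunov_form_basis R b J g"
proof (rule kernel_behavior_jet_basis[OF no_exponential_solution])
  fix J g
  assume basis: "finite J" "\<And>i. (0, i) \<in> J"
    "\<And>j. j \<in> J \<Longrightarrow> g j \<in> B"
    "\<And>w. w \<in> B \<Longrightarrow> w = (\<lambda>t. \<Sum>j\<in>J. jet j w 0 *\<^sub>R g j t)"
    "\<And>w c t. w \<in> B \<Longrightarrow> (\<And>t. t \<ge> 0 \<Longrightarrow> (\<Sum>j\<in>J. c j * jet j w t) = 0) \<Longrightarrow>
      (\<Sum>j\<in>J. c j * jet j w t) = 0"
  have "lyapunov_form_basis R b J g"
    by unfold_locales
      (fact basis(1), fact basis(2), erule basis(3), erule basis(4), rule basis(5), assumption, blast)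
  then show ?thesis by blast
qed

lemma stable: "stable_behavior B"
  using basis_exists lyapunov_form_basis.stable by blast

lemma asymptotically_stable:
  assumes "\<And>w. w \<in> B \<Longrightarrow> (\<And>t. b w w t = b w w 0) \<Longrightarrow> w = (\<lambda>t. 0)"
  shows "asymptotically_stable_behavior B"
  using basis_exists lyapunov_form_basis.asymptotically_stable[OF _ assms] by blast

end

subsection \<open>Quadratic differential forms\<close>

text \<open>The bilinear form with diagonal \<open>qdf\<close>, from which
  \<open>lyapunov_form\<close> is instantiated.\<close>

definition bdf :: "'q::finite poly2_matrix \<Rightarrow> 'q signal \<Rightarrow> 'q signal \<Rightarrow> real \<Rightarrow> real" where
  "bdf \<Phi> v w t = (\<Sum>k\<le>degree \<Phi>. \<Sum>l\<le>degree (coeff \<Phi> k).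
     (ddt ^^ k) v t \<bullet> (coeff2 \<Phi> k l *v (ddt ^^ l) w t))"

lemma qdf_eq_bdf: "qdf \<Phi> w = bdf \<Phi> w w"
  by (simp add: fun_eq_iff qdf_def bdf_def)

lemma
  assumes "smooth u" and "smooth v"
  shows bdf_add_left: "bdf \<Phi> (\<lambda>t. u t + v t) w s = bdf \<Phi> u w s + bdf \<Phi> v w s"
    and bdf_add_right: "bdf \<Phi> w (\<lambda>t. u t + v t) s = bdf \<Phi> w u s + bdf \<Phi> w v s"
  using assms
  by (simp_all add: bdf_def funpow_ddt_add inner_add_left inner_add_right sum.distrib
      matrix_vector_right_distrib)

lemma
  assumes "smooth v"
  shows bdf_scaleR_left: "bdf \<Phi> (\<lambda>t. c *\<^sub>R v t) w s = c * bdf \<Phi> v w s"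
    and bdf_scaleR_right: "bdf \<Phi> w (\<lambda>t. c *\<^sub>R v t) s = c * bdf \<Phi> w v s"
  using assms
  by (simp_all add: bdf_def funpow_ddt_scaleR sum_distrib_left matrix_vector_mult_scaleR)

lemma bdf_shift:
  assumes "smooth v" and "smooth w"
  shows "bdf \<Phi> (\<lambda>t. v (t + a)) (\<lambda>t. w (t + a)) s = bdf \<Phi> v w (s + a)"
  using assms by (simp add: bdf_def funpow_ddt_shift)

text \<open>Since \<open>ddt\<close> is total, differentiability has to be proved before
  \<open>ddt\<close> denotes a true derivative; the product rule gives it for each summand.\<close>

lemma qdf_has_derivative:
  assumes w: "smooth w"
  shows "(qdf \<Phi> w has_real_derivative ddt (qdf \<Phi> w) t) (at t)"
proof -
  have "(\<lambda>t. (ddt ^^ k) w t \<bullet> (A *v (ddt ^^ l) w t)) differentiable (at t)" for k l A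
  proof -
    have "((\<lambda>t. A *v (ddt ^^ l) w t) has_vector_derivative A *v (ddt ^^ Suc l) w t) (at t)"
      by (rule bounded_linear.has_vector_derivative[OF matrix_vector_mul_bounded_linear
            smooth_has_vector_derivative[OF w]])
    from bounded_bilinear.has_vector_derivative[OF bounded_bilinear_inner
        smooth_has_vector_derivative[OF w] this]
    show ?thesis by (rule differentiableI_vector)
  qed
  then have "qdf \<Phi> w differentiable (at t)"
    unfolding qdf_def[abs_def] by (intro differentiable_sum ballI) auto
  then show ?thesis
    by (simp add: ddt_def vector_derivative_works has_real_derivative_iff_has_vector_derivative)
qed

theorem theorem3:
  fixes B1 B2 :: "'q::finite signal set"
    and \<Phi>1 \<Phi>2 \<Psi>1 \<Psi>2 :: "'q poly2_matrix"
    and \<alpha>1 \<alpha>2 :: real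
  assumes "B1 \<in> behaviors" and "B2 \<in> behaviors"
    and "\<Phi>1 \<in> sym_poly2" and "\<Phi>2 \<in> sym_poly2"
    and "\<Psi>1 \<in> sym_poly2" and "\<Psi>2 \<in> sym_poly2"
    and "storage_function B1 \<Phi>1 \<Psi>1" and "storage_function B2 \<Phi>2 \<Psi>2"
    and "nonneg_on B1 (qdf \<Psi>1)" and "nonneg_on B2 (qdf \<Psi>2)"
    and "\<alpha>1 > 0" and "\<alpha>2 \<ge> 0"
    and "le_on (B1 \<inter> B2) (\<lambda>w t. \<alpha>1 * qdf \<Phi>1 w t + \<alpha>2 * qdf \<Phi>2 w t) (\<lambda>w t. 0)"
  shows "(pos_on B1 (qdf \<Psi>1) \<longrightarrow> stable_behavior (B1 \<inter> B2)) \<and>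
         (strict_dissipation B1 \<Phi>1 \<Psi>1 \<longrightarrow> asymptotically_stable_behavior (B1 \<inter> B2))"
proof -
  obtain R1 R2 where R: "B1 = kernel_behavior R1" "B2 = kernel_behavior R2"
    using assms(1,2) by (auto simp: behaviors_def)
  have B: "B1 \<inter> B2 = kernel_behavior (R1 @ R2)"
    by (auto simp: R kernel_behavior_def)
  define b where "b v w t = \<alpha>1 * bdf \<Psi>1 v w t + \<alpha>2 * bdf \<Psi>2 v w t" for v w t
  have b_qdf: "b w w t = \<alpha>1 * qdf \<Psi>1 w t + \<alpha>2 * qdf \<Psi>2 w t" for w t
    by (simp add: b_def qdf_eq_bdf)
  have nonneg1: "0 \<le> qdf \<Psi>1 w t" if "w \<in> B1" for w t
    using assms(9) that by (simp add: nonneg_on_def)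
  have nonneg2: "0 \<le> qdf \<Psi>2 w t" if "w \<in> B2" for w t
    using assms(10) that by (simp add: nonneg_on_def)
  define V' where "V' w t = \<alpha>1 * ddt (qdf \<Psi>1 w) t + \<alpha>2 * ddt (qdf \<Psi>2 w) t" for w t
  have deriv: "((\<lambda>t. b w w t) has_real_derivative V' w t) (at t)" if "w \<in> B1 \<inter> B2" for w t
    unfolding b_qdf V'_def using that R
    by (intro DERIV_add DERIV_cmult qdf_has_derivative) (auto intro: kernel_behavior_smooth)
  \<comment> \<open>The hypothesis on the supply rates and the second dissipation inequality
    eliminate the terms with index 2; what remains is the gap in the first dissipation inequality,
    weighted by \<open>\<alpha>1\<close>.\<close>
  have V'_le: "V' w t \<le> - \<alpha>1 * (qdf \<Phi>1 w t - ddt (qdf \<Psi>1 w) t)" if "w \<in> B1 \<inter> B2" for w t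
  proof -
    have "0 \<le> 0 - (\<alpha>1 * qdf \<Phi>1 w t + \<alpha>2 * qdf \<Phi>2 w t)"
      using assms(13) that unfolding le_on_def nonneg_on_def by blast
    moreover have "\<alpha>2 * ddt (qdf \<Psi>2 w) t \<le> \<alpha>2 * qdf \<Phi>2 w t"
      using assms(8,12) that
      by (intro mult_left_mono) (auto simp: storage_function_def le_on_def nonneg_on_def)
    ultimately show ?thesis by (simp add: V'_def algebra_simps)
  qed
  have diss1: "0 \<le> qdf \<Phi>1 w t - ddt (qdf \<Psi>1 w) t" if "w \<in> B1 \<inter> B2" for w t
    using assms(7) that by (simp add: storage_function_def le_on_def nonneg_on_def)
  \<comment> \<open>The two claims establish definiteness in different ways, so it is left as a
    premise here.\<close>
  have form: "lyapunov_form (R1 @ R2) b"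
    if definite: "\<And>w. w \<in> B1 \<inter> B2 \<Longrightarrow> (\<And>t. b w w t = 0) \<Longrightarrow> w = (\<lambda>t. 0)"
  proof
    show "0 \<le> b w w t" if "w \<in> kernel_behavior (R1 @ R2)" for w t
      using that nonneg1 nonneg2 assms(11,12) by (simp add: b_qdf flip: B)
    show "b w w t \<le> b w w s" if "w \<in> kernel_behavior (R1 @ R2)" "s \<le> t" for w s t
    proof (rule DERIV_nonpos_imp_nonincreasing[OF that(2)])
      have w: "w \<in> B1 \<inter> B2" using that(1) B by simp
      have "V' w x \<le> 0" for x
        using V'_le[OF w, of x] mult_nonneg_nonneg[OF _ diss1[OF w, of x], of \<alpha>1] assms(11) by simp
      then show "\<exists>y. ((\<lambda>t. b w w t) has_real_derivative y) (at x) \<and> y \<le> 0" for x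
        using deriv[OF w] by blast
    qed
    show "w = (\<lambda>t. 0)" if "w \<in> kernel_behavior (R1 @ R2)" "\<And>t. b w w t = 0" for w
      using that definite B by blast
    show "b (\<lambda>t. v (t + a)) (\<lambda>t. w (t + a)) s = b v w (s + a)" if "smooth v" "smooth w" for v w a s
      using that by (simp add: b_def bdf_shift)
  qed (simp_all add: b_def bdf_add_left bdf_add_right bdf_scaleR_left bdf_scaleR_right
      algebra_simps)
  have "stable_behavior (B1 \<inter> B2)" if pos: "pos_on B1 (qdf \<Psi>1)"
  proof -
    \<comment> \<open>Two nonnegative terms with sum zero both vanish, and \<open>\<alpha>1\<close>
      is positive, so the first storage function is zero along \<open>w\<close>.\<close>
    have "w = (\<lambda>t. 0)" if w: "w \<in> B1 \<inter> B2" and z: "\<And>t. b w w t = 0" for w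
    proof -
      have "qdf \<Psi>1 w t = 0" for t
      proof -
        have "0 \<le> \<alpha>1 * qdf \<Psi>1 w t" "0 \<le> \<alpha>2 * qdf \<Psi>2 w t"
          using w nonneg1 nonneg2 assms(11,12) by auto
        then have "\<alpha>1 * qdf \<Psi>1 w t = 0" using z[of t] unfolding b_qdf by linarith
        then show ?thesis using assms(11) by simp
      qed
      then show ?thesis using pos w by (auto simp: pos_on_def)
    qed
    from lyapunov_form.stable[OF form[OF this]] show ?thesis by (simp add: B)
  qed
  moreover have "asymptotically_stable_behavior (B1 \<inter> B2)" if strict: "strict_dissipation B1 \<Phi>1 \<Psi>1"
  proof -
    \<comment> \<open>Constancy makes \<open>V'\<close> zero, and by \<open>V'_le\<close> the first
      dissipation gap too; strictness then leaves only the zero signal.\<close>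
    have const: "w = (\<lambda>t. 0)" if w: "w \<in> B1 \<inter> B2" and c: "\<And>t. b w w t = b w w 0" for w
    proof -
      have "qdf \<Phi>1 w t - ddt (qdf \<Psi>1 w) t = 0" for t
      proof -
        have "((\<lambda>t. b w w t) has_real_derivative 0) (at t)"
          by (subst c) (rule DERIV_const)
        then have "V' w t = 0" using deriv[OF w] DERIV_unique by blast
        then have "\<alpha>1 * (qdf \<Phi>1 w t - ddt (qdf \<Psi>1 w) t) \<le> 0" using V'_le[OF w, of t] by simp
        then show ?thesis using diss1[OF w, of t] assms(11) by (simp add: mult_le_0_iff)
      qed
      then show ?thesis
        using strict w unfolding strict_dissipation_def less_on_def pos_on_def by blast
    qed
    \<comment> \<open>A form that vanishes identically is constant, so \<open>const\<close> also
      supplies definiteness.\<close>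
    then have "lyapunov_form (R1 @ R2) b" by (intro form) auto
    from lyapunov_form.asymptotically_stable[OF this] show ?thesis using const by (simp add: B)
  qed
  ultimately show ?thesis by blast
qed

end
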